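(* There exist absolute constants $M,M'\in\mathbb{N}$ (independent of all input data) such that the following holds. Let $\alpha\in\mathbb{A}\setminus\mathbb{R}$, $\rho\in\mathbb{A}\cap\mathbb{R}$, and for $i=1,2,3$ let $f_i,h_i\in\mathbb{A}$, $g_i,k_i\in\mathbb{A}\cap\mathbb{R}$ and $s_i,t_i,r_i\in\mathbb{A}\cap\mathbb{R}$. For $n\in\mathbb{N}$ consider the sentence $$\exists \lambda,\mu,\nu\in\mathbb{R}:\ 0\le\lambda,\mu,\nu\le 1\ \wedge\ \mu+\nu\le 1\ \wedge\ \bigwedge_{i=1}^3\Big(f_i\alpha^n+\overline{f_i}\,\overline{\alpha}^n+g_i\rho^n+\lambda\big(h_i\alpha^n+\overline{h_i}\,\overline{\alpha}^n+k_i\rho^n\big)=s_i+\mu t_i+\nu r_i\Big).$$ Then this sentence is equivalent, for every $n\in\mathbb{N}$, to a disjunction $\bigvee_{i=1}^{M}\mathrm{Sys}_i$, where each $\mathrm{Sys}_i$ is a conjunction of at most $M'$ expressions of the form $$A\alpha^{2n}+\overline{A}\,\overline{\alpha}^{2n}+B\alpha^n\rho^n+\overline{B}\,\overline{\alpha}^n\rho^n+C\rho^{2n}+D|\alpha|^{2n}+E\alpha^n+\overline{E}\,\overline{\alpha}^n+F\rho^n+G\bowtie 0,$$ with $\bowtie\in\{>,=\}$, $A,B,E\in\mathbb{A}$ and $C,D,F,G\in\mathbb{A}\cap\mathbb{R}$ (these coefficients not depending on $n$). Moreover, the description of each $\mathrm{Sys}_i$ has size polynomial in the size $\|I\|$ of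 the input data.
   Context: $\mathbb{A}$ denotes the set of algebraic numbers; algebraic numbers are represented by their defining integer polynomial together with a rational disc isolating them from the other roots, and $\|I\|$ denotes the total bit length of the standard representations of $\alpha,\rho,f_i,g_i,h_i,k_i,s_i,t_i,r_i$. $\overline{z}$ denotes complex conjugation. *)

theory Defs
  imports Complex_Main "HOL-Computational_Algebra.Polynomial" "HOL-Library.Log_Nat"
begin

abbreviation algebraic_numbers :: "complex set"  (\<open>\<bbbA>\<close>)
  where "\<bbbA> \<equiv> {z. algebraic z}"

section \<open>Representing algebraic numbers\<close>

text \<open>The sign condition selects one of the two candidates that differ only by a factor \<open>-1\<close>.\<close>

definition defining_poly :: "int poly \<Rightarrow> complex \<Rightarrow> bool"
  where "defining_poly p z \<longleftrightarrow>
    p \<noteq> 0 \<and> poly (map_poly of_int p) z = 0 \<and>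
    (\<forall>q::int poly. q \<noteq> 0 \<longrightarrow> poly (map_poly of_int q) z = 0 \<longrightarrow> degree p \<le> degree q) \<and>
    content p = 1 \<and> lead_coeff p > 0"

datatype alg_rep =
  Alg_Rep (rep_poly: "int poly") (rep_re: rat) (rep_im: rat) (rep_radius: rat)

definition rep_disc :: "alg_rep \<Rightarrow> complex set"
  where "rep_disc R =
    {w. cmod (w - Complex (of_rat (rep_re R)) (of_rat (rep_im R))) < of_rat (rep_radius R)}"

definition represents :: "alg_rep \<Rightarrow> complex \<Rightarrow> bool"
  where "represents R z \<longleftrightarrow>
    defining_poly (rep_poly R) z \<and>
    {w. poly (map_poly of_int (rep_poly R)) w = 0} \<inter> rep_disc R = {z}"

text \<open>Bit lengths: integers are written in binary with a sign bit, rationals as reduced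
  fractions, polynomials as the dense list of their coefficients.\<close>

definition int_size :: "int \<Rightarrow> nat"
  where "int_size k = 1 + floorlog 2 (nat \<bar>k\<bar>)"

definition rat_size :: "rat \<Rightarrow> nat"
  where "rat_size q = int_size (fst (quotient_of q)) + int_size (snd (quotient_of q))"

definition poly_size :: "int poly \<Rightarrow> nat"
  where "poly_size p = (\<Sum>c\<leftarrow>coeffs p. int_size c)"

definition rep_size :: "alg_rep \<Rightarrow> nat"
  where "rep_size R =
    poly_size (rep_poly R) + rat_size (rep_re R) + rat_size (rep_im R) + rat_size (rep_radius R)"

section \<open>Systems of polynomial-exponential constraints\<close>

datatype comparison = Greater | Equal

text \<open>The type of coefficients is a parameter: an atom with complex coefficients is a constraint,
  an atom with coefficients in \<^typ>\<open>alg_rep\<close> is a description of one.\<close>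

datatype 'a atom = Atom (coeff_A: 'a) (coeff_B: 'a) (coeff_C: 'a) (coeff_D: 'a)
  (coeff_E: 'a) (coeff_F: 'a) (coeff_G: 'a) (atom_cmp: comparison)

definition admissible :: "complex atom \<Rightarrow> bool"
  where "admissible \<phi> \<longleftrightarrow>
    {coeff_A \<phi>, coeff_B \<phi>, coeff_E \<phi>} \<subseteq> \<bbbA> \<and>
    {coeff_C \<phi>, coeff_D \<phi>, coeff_F \<phi>, coeff_G \<phi>} \<subseteq> \<bbbA> \<inter> \<real>"

fun atom_value :: "complex \<Rightarrow> complex \<Rightarrow> nat \<Rightarrow> complex atom \<Rightarrow> complex"
  where "atom_value \<alpha> \<rho> n (Atom A B C D E F G c) =
    A * \<alpha> ^ (2 * n) + cnj A * cnj \<alpha> ^ (2 * n)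
    + B * \<alpha> ^ n * \<rho> ^ n + cnj B * cnj \<alpha> ^ n * \<rho> ^ n
    + C * \<rho> ^ (2 * n) + D * of_real (cmod \<alpha> ^ (2 * n))
    + E * \<alpha> ^ n + cnj E * cnj \<alpha> ^ n + F * \<rho> ^ n + G"

text \<open>For admissible atoms and real \<open>\<rho>\<close> the value is real, so \<^const>\<open>Re\<close> below only changes the
  type.\<close>

definition atom_holds :: "complex \<Rightarrow> complex \<Rightarrow> nat \<Rightarrow> complex atom \<Rightarrow> bool"
  where "atom_holds \<alpha> \<rho> n \<phi> \<longleftrightarrow>
    (case atom_cmp \<phi> of
      Greater \<Rightarrow> Re (atom_value \<alpha> \<rho> n \<phi>) > 0
    | Equal \<Rightarrow> atom_value \<alpha> \<rho> n \<phi> = 0)"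

lemma atom_value_real:
  assumes "admissible \<phi>" and "\<rho> \<in> \<real>"
  shows "atom_value \<alpha> \<rho> n \<phi> \<in> \<real>"
  using assms
  by (cases \<phi>) (auto simp: admissible_def Reals_cnj_iff ac_simps)

definition describes :: "alg_rep atom list \<Rightarrow> complex atom list \<Rightarrow> bool"
  where "describes = list_all2 (rel_atom represents)"

text \<open>The summand \<open>1\<close> is the bit for the comparison sign.\<close>

definition atom_size :: "alg_rep atom \<Rightarrow> nat"
  where "atom_size \<delta> = rep_size (coeff_A \<delta>) + rep_size (coeff_B \<delta>) + rep_size (coeff_C \<delta>)
    + rep_size (coeff_D \<delta>) + rep_size (coeff_E \<delta>) + rep_size (coeff_F \<delta>)
    + rep_size (coeff_G \<delta>) + 1"

definition description_size :: "alg_rep atom list \<Rightarrow> nat"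
  where "description_size \<Delta> = (\<Sum>\<delta>\<leftarrow>\<Delta>. atom_size \<delta>)"

text \<open>Every algebraic number has a representation, so bounds quantified over all representations
  are not vacuous.\<close>

lemma ex_defining_poly:
  assumes "algebraic z"
  shows "\<exists>p. defining_poly p z"
proof -
  define P where "P q \<longleftrightarrow> q \<noteq> 0 \<and> poly (map_poly of_int q) z = 0" for q :: "int poly"
  obtain p0 where p0: "\<And>i. coeff p0 i \<in> \<int>" "p0 \<noteq> 0" "poly p0 z = 0"
    using assms unfolding algebraic_def by blast
  define q1 :: "int poly" where "q1 = map_poly (\<lambda>x. \<lfloor>Re x\<rfloor>) p0"
  have "p0 = map_poly of_int q1"
  proof (rule poly_eqI)
    show "coeff p0 i = coeff (map_poly of_int q1) i" for i
      using p0(1)[of i] by (auto simp: q1_def coeff_map_poly elim!: Ints_cases)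
  qed
  then have "P q1" using p0 by (auto simp: P_def)
  then obtain q where q: "P q" and least: "\<And>q'. P q' \<Longrightarrow> degree q \<le> degree q'"
    by (metis ex_has_least_nat[of P q1 degree])
  have q_nz: "q \<noteq> 0" using q by (simp add: P_def)
  obtain c u where cu: "c = content q" "u = primitive_part q" by simp
  have q_eq: "q = smult c u" by (simp add: cu)
  have "c \<ge> 0"
    using normalize_content[of q] abs_ge_zero[of "content q"] by (simp add: cu)
  then have c_pos: "c > 0" using q_nz q_eq by (cases "c = 0") auto
  have u: "content u = 1" "u \<noteq> 0" using q_nz by (auto simp: cu)
  define p where "p = smult (sgn (lead_coeff u)) u"
  have s: "sgn (lead_coeff u) = 1 \<or> sgn (lead_coeff u) = -1"
    using u(2) by (auto simp: sgn_if)
  have deg: "degree p = degree q" using s c_pos by (auto simp: p_def q_eq)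
  have p_nz: "p \<noteq> 0" using s u by (auto simp: p_def)
  have "poly (map_poly of_int u) z = 0"
    using q c_pos by (simp add: P_def q_eq map_poly_smult)
  then have root: "poly (map_poly of_int p) z = 0"
    by (simp add: p_def map_poly_smult)
  have cont: "content p = 1"
    using s u by (auto simp: p_def)
  have "lead_coeff p = \<bar>lead_coeff u\<bar>"
    unfolding p_def lead_coeff_smult by (metis abs_sgn mult.commute)
  then have "lead_coeff p > 0" using u(2) by simp
  then show ?thesis
    using p_nz root cont least deg by (auto simp: defining_poly_def P_def)
qed

lemma ex_represents:
  assumes "algebraic z"
  shows "\<exists>R. represents R z"
proof -
  obtain p where p: "defining_poly p z" using ex_defining_poly[OF assms] by blast
  define Z where "Z = {w::complex. poly (map_poly of_int p) w = 0}"
  have "finite Z"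
    using p unfolding Z_def defining_poly_def by (intro poly_roots_finite) (auto simp: map_poly_eq_0_iff)
  have zZ: "z \<in> Z" using p by (auto simp: Z_def defining_poly_def)
  obtain e where e: "e > 0" "\<And>w. w \<in> Z \<Longrightarrow> w \<noteq> z \<Longrightarrow> e < cmod (w - z)"
  proof
    define D where "D = insert 1 ((\<lambda>w. cmod (w - z)) ` (Z - {z}))"
    have D: "finite D" "D \<noteq> {}" "\<And>x. x \<in> D \<Longrightarrow> x > 0"
      using \<open>finite Z\<close> by (auto simp: D_def)
    then have m: "Min D > 0" by simp
    show "Min D / 2 > 0" using m by simp
    show "Min D / 2 < cmod (w - z)" if "w \<in> Z" "w \<noteq> z" for w
    proof -
      have "Min D \<le> cmod (w - z)" using that D by (intro Min_le) (auto simp: D_def)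
      then show ?thesis using m by linarith
    qed
  qed
  obtain r where r: "0 < real_of_rat r" "real_of_rat r < e / 2"
    using of_rat_dense[of 0 "e / 2"] e(1) by auto
  obtain a where a: "Re z - of_rat r / 2 < of_rat a" "of_rat a < Re z"
    using of_rat_dense[of "Re z - of_rat r / 2" "Re z"] r(1) by auto
  obtain b where b: "Im z - of_rat r / 2 < of_rat b" "of_rat b < Im z"
    using of_rat_dense[of "Im z - of_rat r / 2" "Im z"] r(1) by auto
  define c where "c = Complex (of_rat a) (of_rat b)"
  have zc: "cmod (z - c) < of_rat r"
    using cmod_le[of "z - c"] a b by (simp add: c_def)
  have "w = z" if "w \<in> Z" "cmod (w - c) < of_rat r" for w
  proof (rule ccontr)
    assume "w \<noteq> z"
    then have "e < cmod (w - z)" using e that by blast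
    also have "cmod (w - z) \<le> cmod (w - c) + cmod (z - c)"
      using norm_triangle_ineq4[of "w - c" "z - c"] by simp
    finally show False using that zc r by linarith
  qed
  then have "Z \<inter> {w. cmod (w - c) < of_rat r} = {z}"
    using zc zZ by blast
  then have "represents (Alg_Rep p a b r) z"
    using p by (simp only: represents_def rep_disc_def alg_rep.sel c_def Z_def simp_thms)
  then show ?thesis by blast
qed

end

theory Submission
  imports Defs "HOL-Computational_Algebra.Fundamental_Theorem_Algebra" "HOL-Library.FuncSet"
begin

text \<open>Write every equation as two inequalities. All constraints are then linear in \<open>\<nu>\<close> and \<open>\<mu>\<close> with
  constant coefficients, and linear in \<open>\<lambda>\<close> with coefficients that are affine in \<open>\<alpha>\<^sup>n\<close>, its conjugate
  and \<open>\<rho>\<^sup>n\<close>. Fourier-Motzkin elimination of \<open>\<nu>\<close> and \<open>\<mu>\<close> preserves this shape, and eliminating \<open>\<lambda>\<close>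
  last produces only products of two affine forms. Hence the truth of the sentence depends only on
  the signs of boundedly many quadratic forms of the required shape, and the disjuncts are the
  sign patterns that occur at some \<open>n\<close> for which the sentence is true.

  For the size bound, measure an algebraic number by the degree and the bit length of the
  coefficients of some integer polynomial annihilating it. If \<open>y\<close> and \<open>z\<close> are roots of integer
  polynomials of degrees \<open>m\<close> and \<open>n\<close>, then the powers of a suitable integer multiple of \<open>y + z\<close>,
  \<open>y - z\<close> or \<open>y z\<close> are integer combinations of the monomials \<open>y\<^sup>i z\<^sup>j\<close> with \<open>i < m\<close>, \<open>j < n\<close>, and the
  pigeonhole principle yields a small linear relation between the first \<open>m n + 1\<close> of them. The
  measure therefore grows polynomially under each of the boundedly many ring operations. It
  controls the standard representation: the defining polynomial divides the annihilating one, and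
  the distance of two of its roots is bounded below since their difference is again annihilated
  by a small polynomial.\<close>

section \<open>Annihilating polynomials of sums and products\<close>

text \<open>A form of Siegel's lemma. Coefficient vectors with entries in \<open>{0..C}\<close>
  outnumber the values they can take under the linear map, so two of them collide, and their
  difference is the relation.\<close>

lemma ex_small_int_relation:
  fixes a :: "nat \<Rightarrow> 'e \<Rightarrow> int" and A :: nat
  assumes "finite E" and D: "card E = D"
    and a: "\<And>k e. k \<le> D \<Longrightarrow> e \<in> E \<Longrightarrow> \<bar>a k e\<bar> \<le> int A" and "A \<ge> 1"
  obtains c :: "nat \<Rightarrow> int" where
    "\<exists>k\<le>D. c k \<noteq> 0" and "\<And>k. k \<le> D \<Longrightarrow> \<bar>c k\<bar> \<le> int ((2 * (D + 1) * A) ^ D)"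
    and "\<And>e. e \<in> E \<Longrightarrow> (\<Sum>k\<le>D. c k * a k e) = 0"
proof -
  \<comment> \<open>This \<open>C\<close> closes the count:
    \<open>(2 * (D + 1) * C * A + 1) ^ D\<close> is at most
    \<open>(2 * (D + 1) * A) ^ D * (C + 1) ^ D\<close>, and the first factor is \<open>C\<close>,
    which is below \<open>C + 1\<close>.\<close>
  define C where "C = (2 * (D + 1) * A) ^ D"
  define X where "X = PiE {..D} (\<lambda>_. {0..int C})"
  define T where "T = int ((D + 1) * C * A)"
  define Y where "Y = PiE E (\<lambda>_. {-T..T})"
  define F where "F x = (\<lambda>e\<in>E. \<Sum>k\<le>D. x k * a k e)" for x :: "nat \<Rightarrow> int"
  have "finite Y" unfolding Y_def using \<open>finite E\<close> by (intro finite_PiE) auto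
  have "card X = (C + 1) ^ (D + 1)"
    unfolding X_def by (simp add: card_PiE nat_add_distrib)
  have "card Y = (2 * ((D + 1) * C * A) + 1) ^ D"
  proof -
    have "nat (T - (- T) + 1) = 2 * ((D + 1) * C * A) + 1" unfolding T_def by linarith
    then show ?thesis unfolding Y_def using \<open>finite E\<close> by (simp add: card_PiE D)
  qed
  also have "\<dots> \<le> ((2 * (D + 1) * A) * (C + 1)) ^ D"
    using \<open>A \<ge> 1\<close> by (intro power_mono) (auto simp: algebra_simps)
  also have "\<dots> = C * (C + 1) ^ D" unfolding C_def power_mult_distrib ..
  also have "\<dots> < (C + 1) ^ (D + 1)" by simp
  finally have "card Y < card X" using \<open>card X = _\<close> by simp
  moreover have "F ` X \<subseteq> Y"
  proof
    fix y assume "y \<in> F ` X"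
    then obtain x where x: "x \<in> X" and y: "y = F x" by blast
    have "\<bar>\<Sum>k\<le>D. x k * a k e\<bar> \<le> T" if "e \<in> E" for e
    proof -
      have "\<bar>\<Sum>k\<le>D. x k * a k e\<bar> \<le> (\<Sum>k\<le>D. \<bar>x k * a k e\<bar>)" by (rule sum_abs)
      also have "\<dots> \<le> (\<Sum>k\<le>D. int C * int A)"
      proof (rule sum_mono)
        fix k assume "k \<in> {..D}"
        then have "0 \<le> x k" "x k \<le> int C" using x by (auto simp: X_def PiE_def Pi_def)
        then show "\<bar>x k * a k e\<bar> \<le> int C * int A"
          unfolding abs_mult using a[of k e] that \<open>k \<in> {..D}\<close> by (intro mult_mono) auto
      qed
      also have "\<dots> = T" by (simp add: T_def algebra_simps)
      finally show ?thesis .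
    qed
    then show "y \<in> Y" unfolding y F_def Y_def by (fastforce simp: abs_le_iff)
  qed
  then have "card (F ` X) \<le> card Y" using \<open>finite Y\<close> by (rule card_mono[rotated])
  ultimately have "card (F ` X) < card X" by simp
  then have "\<not> inj_on F X" using card_image by fastforce
  then obtain x y where xy: "x \<in> X" "y \<in> X" "x \<noteq> y" "F x = F y" unfolding inj_on_def by blast
  show ?thesis
  proof (rule that)
    show "\<exists>k\<le>D. x k - y k \<noteq> 0"
    proof (rule ccontr)
      assume "\<not> ?thesis"
      then have "x k = y k" if "k \<in> {..D}" for k using that by auto
      then have "x = y" using xy(1,2) unfolding X_def by (rule PiE_ext[rotated 2])
      then show False using xy(3) by simp
    qed
    fix k assume "k \<le> D"
    then have "x k \<in> {0..int C}" "y k \<in> {0..int C}" using xy by (auto simp: X_def PiE_def Pi_def)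
    then show "\<bar>x k - y k\<bar> \<le> int ((2 * (D + 1) * A) ^ D)" unfolding C_def[symmetric] by auto
  next
    fix e assume "e \<in> E"
    then have "(\<Sum>k\<le>D. x k * a k e) = (\<Sum>k\<le>D. y k * a k e)"
      using fun_cong[OF xy(4), of e] by (simp add: F_def)
    then show "(\<Sum>k\<le>D. (x k - y k) * a k e) = 0"
      by (simp add: left_diff_distrib sum_subtractf)
  qed
qed

section \<open>Algebraic numbers with bounded annihilating polynomials\<close>

abbreviation ipoly :: "int poly \<Rightarrow> complex \<Rightarrow> complex"
  where "ipoly p \<equiv> poly (map_poly of_int p)"

lemma ipoly_altdef:
  assumes "degree p \<le> n"
  shows "ipoly p z = (\<Sum>i\<le>n. of_int (coeff p i) * z ^ i)"
proof -
  have "ipoly p z = (\<Sum>i\<le>degree p. of_int (coeff p i) * z ^ i)"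
    by (subst poly_altdef) (simp add: degree_map_poly coeff_map_poly)
  also have "\<dots> = (\<Sum>i\<le>n. of_int (coeff p i) * z ^ i)"
    using assms by (intro sum.mono_neutral_left) (auto simp: coeff_eq_0)
  finally show ?thesis .
qed

text \<open>One parameter bounds both the degree and the bit length of the coefficients. The
  polynomial need not be minimal, so ring operations can be followed without factoring.\<close>

definition bounded_root :: "nat \<Rightarrow> complex \<Rightarrow> bool"
  where "bounded_root S z \<longleftrightarrow>
    (\<exists>p. p \<noteq> 0 \<and> degree p \<le> S \<and> (\<forall>i. \<bar>coeff p i\<bar> \<le> 2 ^ S) \<and> ipoly p z = 0)"

lemma bounded_root_mono:
  assumes "bounded_root S z" and "S \<le> T"
  shows "bounded_root T z"
proof -
  have "(2::int) ^ S \<le> 2 ^ T" using assms by simp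
  then show ?thesis using assms unfolding bounded_root_def by (meson order_trans)
qed

lemma bounded_root_cnj:
  assumes "bounded_root S z"
  shows "bounded_root S (cnj z)"
proof -
  have "ipoly p (cnj z) = cnj (ipoly p z)" for p
    by (simp add: ipoly_altdef[OF order_refl])
  then show ?thesis using assms unfolding bounded_root_def by auto
qed

lemma bounded_root_0_1: "bounded_root 1 0" "bounded_root 1 1"
proof -
  have *: "\<bar>coeff [:a, 1:] i\<bar> \<le> (2::int) ^ 1" if "\<bar>a\<bar> \<le> 1" for i a
    using that by (auto simp: coeff_pCons split: nat.splits)
  show "bounded_root 1 0"
    unfolding bounded_root_def using *[of 0] by (intro exI[of _ "[:0, 1:]"]) (auto simp: map_poly_pCons)
  show "bounded_root 1 1"
    unfolding bounded_root_def using *[of "-1"] by (intro exI[of _ "[:-1, 1:]"]) (auto simp: map_poly_pCons)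
qed

section \<open>Integer combinations of monomials in two algebraic numbers\<close>

text \<open>The monomials may be linearly dependent, so \<open>B\<close> bounds the coefficients of
  some expression for \<open>x\<close>; no uniqueness is claimed.\<close>

definition int_span :: "nat \<Rightarrow> nat \<Rightarrow> complex \<Rightarrow> complex \<Rightarrow> int \<Rightarrow> complex \<Rightarrow> bool"
  where "int_span m n y z B x \<longleftrightarrow>
    (\<exists>a. (\<forall>i j. \<bar>a i j\<bar> \<le> B) \<and> x = (\<Sum>i<m. \<Sum>j<n. of_int (a i j) * y ^ i * z ^ j))"

lemma int_span_1:
  assumes "m > 0" and "n > 0"
  shows "int_span m n y z 1 1"
proof -
  have "(\<Sum>i<m. \<Sum>j<n. of_int (if i = 0 \<and> j = 0 then 1 else 0) * y ^ i * z ^ j) =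
      (\<Sum>i<m. \<Sum>j<n. if j = 0 then (if i = 0 then 1 else 0) else 0)"
    by (intro sum.cong refl) auto
  also have "\<dots> = (1::complex)" using assms by (simp add: sum.delta)
  finally show ?thesis
    unfolding int_span_def
    by (intro exI[of _ "\<lambda>i j. if i = 0 \<and> j = 0 then 1 else 0"]) auto
qed

lemma int_span_scale:
  assumes "int_span m n y z B x" and "\<bar>c\<bar> \<le> C"
  shows "int_span m n y z (C * B) (of_int c * x)"
proof -
  obtain a where a: "\<forall>i j. \<bar>a i j\<bar> \<le> B" "x = (\<Sum>i<m. \<Sum>j<n. of_int (a i j) * y ^ i * z ^ j)"
    using assms unfolding int_span_def by blast
  then show ?thesis using assms(2) unfolding int_span_def
    by (intro exI[of _ "\<lambda>i j. c * a i j"])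
      (auto simp: abs_mult sum_distrib_left mult.assoc intro!: mult_mono)
qed

lemma int_span_add:
  assumes "int_span m n y z B x" and "int_span m n y z B' x'"
  shows "int_span m n y z (B + B') (x + x')"
proof -
  obtain a where a: "\<forall>i j. \<bar>a i j\<bar> \<le> B" "x = (\<Sum>i<m. \<Sum>j<n. of_int (a i j) * y ^ i * z ^ j)"
    using assms unfolding int_span_def by blast
  obtain b where b: "\<forall>i j. \<bar>b i j\<bar> \<le> B'" "x' = (\<Sum>i<m. \<Sum>j<n. of_int (b i j) * y ^ i * z ^ j)"
    using assms unfolding int_span_def by blast
  have "\<bar>a i j + b i j\<bar> \<le> B + B'" for i j
    using a(1) b(1) abs_triangle_ineq[of "a i j" "b i j"] by (meson add_mono order_trans)
  then show ?thesis unfolding int_span_def a(2) b(2)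
    by (intro exI[of _ "\<lambda>i j. a i j + b i j"])
      (auto simp: sum.distrib[symmetric] algebra_simps)
qed

lemma int_span_swap: "int_span m n y z B x \<longleftrightarrow> int_span n m z y B x"
proof -
  have "int_span n m z y B x" if "int_span m n y z B x" for m n y z
  proof -
    obtain a where "\<forall>i j. \<bar>a i j\<bar> \<le> B" "x = (\<Sum>i<m. \<Sum>j<n. of_int (a i j) * y ^ i * z ^ j)"
      using \<open>int_span m n y z B x\<close> unfolding int_span_def by blast
    then show ?thesis unfolding int_span_def
      by (intro exI[of _ "\<lambda>i j. a j i"]) (auto simp: ac_simps intro: sum.swap)
  qed
  then show ?thesis by blast
qed

text \<open>Multiplication by \<open>y\<close> shifts the exponents of \<open>y\<close> by one. Only
  \<open>y ^ m\<close> leaves the range, and the equation for \<open>y\<close> rewrites it; the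
  factor \<open>lead_coeff p\<close> avoids a division. Each new coefficient is a difference of two
  products of size at most \<open>H * B\<close>.\<close>

lemma int_span_mult_root:
  assumes "ipoly p y = 0" and deg: "degree p = m" "m > 0" and H: "\<And>i. \<bar>coeff p i\<bar> \<le> H"
    and "int_span m n y z B x"
  shows "int_span m n y z (2 * H * B) (of_int (lead_coeff p) * y * x)"
proof -
  obtain a where a: "\<And>i j. \<bar>a i j\<bar> \<le> B" and x: "x = (\<Sum>i<m. \<Sum>j<n. of_int (a i j) * y ^ i * z ^ j)"
    using assms(5) unfolding int_span_def by blast
  obtain d where d: "m = Suc d" using \<open>m > 0\<close> gr0_implies_Suc by blast
  define L where "L = lead_coeff p"
  define w where "w i = (\<Sum>j<n. of_int (a i j) * z ^ j)" for i
  define w' where "w' i = (if i = 0 then 0 else w (i - 1))" for i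
  define b where "b i j = (if i = 0 then 0 else L * a (i - 1) j) - a d j * coeff p i" for i j
  have "ipoly p y = (\<Sum>i\<le>m. of_int (coeff p i) * y ^ i)"
    by (rule ipoly_altdef) (simp add: deg)
  also have "\<dots> = (\<Sum>i<m. of_int (coeff p i) * y ^ i) + of_int L * y ^ m"
    using deg by (simp add: lessThan_Suc_atMost[symmetric] L_def)
  finally have top: "of_int L * y ^ m = - (\<Sum>i<m. of_int (coeff p i) * y ^ i)"
    using assms(1) by (simp add: eq_neg_iff_add_eq_0 add.commute)
  have x': "x = (\<Sum>i<m. w i * y ^ i)"
    unfolding x w_def by (simp add: sum_distrib_left sum_distrib_right ac_simps)
  have "(\<Sum>i<m. w' i * y ^ i) = y * (\<Sum>i<d. w i * y ^ i)"
    unfolding d sum.lessThan_Suc_shift by (simp add: w'_def sum_distrib_left ac_simps)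
  then have "y * x = (\<Sum>i<m. w' i * y ^ i) + w d * y ^ m"
    unfolding x' d by (simp add: algebra_simps)
  then have "of_int L * (y * x) = of_int L * (\<Sum>i<m. w' i * y ^ i) + w d * (of_int L * y ^ m)"
    by (simp add: distrib_left mult.left_commute)
  then have "of_int L * y * x = of_int L * (\<Sum>i<m. w' i * y ^ i) + w d * (of_int L * y ^ m)"
    by (simp only: mult.assoc)
  also have "\<dots> = (\<Sum>i<m. (of_int L * w' i - w d * of_int (coeff p i)) * y ^ i)"
    unfolding top by (simp add: algebra_simps sum_distrib_left sum_subtractf)
  also have "\<dots> = (\<Sum>i<m. \<Sum>j<n. of_int (b i j) * y ^ i * z ^ j)"
    by (intro sum.cong refl)
      (auto simp: b_def w'_def w_def sum_distrib_left sum_distrib_right sum_subtractf algebra_simps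
        simp flip: sum_negf intro!: sum.cong)
  finally have "of_int L * y * x = \<dots>" .
  moreover have "\<bar>b i j\<bar> \<le> 2 * H * B" for i j
  proof -
    have H0: "0 \<le> H" "\<bar>L\<bar> \<le> H" using H[of 0] H[of m] deg by (auto simp: L_def)
    have "0 \<le> B" using a[of 0 0] by linarith
    have "\<bar>L * a (i - 1) j\<bar> \<le> H * B" "\<bar>a d j * coeff p i\<bar> \<le> H * B"
      unfolding abs_mult using a H H0 \<open>0 \<le> B\<close>
      by (auto intro!: mult_mono simp: mult.commute[of "\<bar>a d j\<bar>"])
    moreover have "0 \<le> H * B" using H0 \<open>0 \<le> B\<close> by simp
    ultimately show ?thesis unfolding b_def mult.assoc by (cases "i = 0") auto
  qed
  ultimately show ?thesis unfolding int_span_def L_def by blast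
qed

text \<open>With \<open>D\<close> monomials, where \<open>D\<close> is at most \<open>S\<close>
  squared, the relation costs \<open>D * (1 + D * (2 * S + 3))\<close> bits and clearing
  denominators costs \<open>D * (2 * S + 2)\<close>; together this is
  \<open>D * (D + 1) * (2 * S + 3)\<close>. The last summand makes \<open>le_op_bound\<close>
  immediate.\<close>

definition op_bound :: "nat \<Rightarrow> nat"
  where "op_bound S = S\<^sup>2 * (S\<^sup>2 + 1) * (2 * S + 3) + S"

lemma le_op_bound: "S \<le> op_bound S"
  by (simp add: op_bound_def)

text \<open>Repeated multiplication by \<open>L * w\<close> keeps the powers of \<open>L * w\<close>
  in the span with controlled coefficients. The first \<open>D + 1\<close> of them are integer
  vectors of dimension \<open>D = m * n\<close>, so the pigeonhole lemma relates them. This takes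
  the place of resultants.\<close>

lemma bounded_root_of_int_span:
  assumes "m > 0" "n > 0" "m \<le> S" "n \<le> S" and L: "L \<noteq> 0" "\<bar>L\<bar> \<le> K" and K: "K = 2 ^ (2 * S + 2)"
    and step: "\<And>B x. int_span m n y z B x \<Longrightarrow> int_span m n y z (K * B) (of_int L * w * x)"
  shows "bounded_root (op_bound S) w"
proof -
  define D where "D = m * n"
  define E where "E = {..<m} \<times> {..<n}"
  have E: "finite E" "card E = D" by (auto simp: E_def D_def)
  have pw: "int_span m n y z (K ^ k) ((of_int L * w) ^ k)" for k
  proof (induction k)
    case 0 then show ?case using int_span_1 assms by simp
  next
    case (Suc k) then show ?case using step by fastforce
  qed
  then have "\<exists>a. \<forall>k. (\<forall>i j. \<bar>a k i j\<bar> \<le> K ^ k) \<and>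
      (of_int L * w) ^ k = (\<Sum>i<m. \<Sum>j<n. of_int (a k i j) * y ^ i * z ^ j)"
    unfolding int_span_def by (intro choice allI) blast
  then obtain a where a: "\<And>k i j. \<bar>a k i j\<bar> \<le> K ^ k"
    and aw: "\<And>k. (of_int L * w) ^ k = (\<Sum>i<m. \<Sum>j<n. of_int (a k i j) * y ^ i * z ^ j)"
    by blast
  \<comment> \<open>All powers up to \<open>D\<close> need a common bound; \<open>K ^ D\<close>
    serves because \<open>K\<close> is at least 1.\<close>
  define A where "A = (2::nat) ^ ((2 * S + 2) * D)"
  have A: "int A = K ^ D" unfolding A_def K power_mult by simp
  have "K \<ge> 1" unfolding K by (rule one_le_power) simp
  obtain c where c0: "\<exists>k\<le>D. c k \<noteq> 0" and c: "\<And>k. k \<le> D \<Longrightarrow> \<bar>c k\<bar> \<le> int ((2 * (D + 1) * A) ^ D)"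
    and crel: "\<And>e. e \<in> E \<Longrightarrow> (\<Sum>k\<le>D. c k * a k (fst e) (snd e)) = 0"
  proof (rule ex_small_int_relation[OF E])
    show "\<bar>a k (fst e) (snd e)\<bar> \<le> int A" if "k \<le> D" for k e
      using a[of k "fst e" "snd e"] power_increasing[OF that \<open>K \<ge> 1\<close>] unfolding A by linarith
    show "A \<ge> 1" unfolding A_def by simp
  qed (rule that)
  \<comment> \<open>The relation between powers of \<open>L * w\<close> becomes a polynomial in
    \<open>w\<close> by moving \<open>L ^ k\<close> into the coefficient.\<close>
  define p where "p = (\<Sum>k\<le>D. monom (c k * L ^ k) k)"
  have coeff_p: "coeff p k = (if k \<le> D then c k * L ^ k else 0)" for k
    unfolding p_def by (simp add: coeff_sum if_distrib cong: if_cong)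
  have "p \<noteq> 0" using c0 coeff_p L by (metis coeff_0 mult_eq_0_iff power_not_zero)
  have degp: "degree p \<le> D" by (rule degree_le) (simp add: coeff_p)
  have "ipoly p w = (\<Sum>k\<le>D. of_int (c k) * (of_int L * w) ^ k)"
    unfolding ipoly_altdef[OF degp] by (simp add: coeff_p power_mult_distrib mult.assoc)
  also have "\<dots> = (\<Sum>k\<le>D. \<Sum>i<m. \<Sum>j<n. of_int (c k * a k i j) * (y ^ i * z ^ j))"
    unfolding aw by (simp add: sum_distrib_left mult.assoc)
  also have "\<dots> = (\<Sum>i<m. \<Sum>k\<le>D. \<Sum>j<n. of_int (c k * a k i j) * (y ^ i * z ^ j))"
    by (rule sum.swap)
  also have "\<dots> = (\<Sum>i<m. \<Sum>j<n. \<Sum>k\<le>D. of_int (c k * a k i j) * (y ^ i * z ^ j))"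
    by (intro sum.cong refl sum.swap)
  also have "\<dots> = (\<Sum>i<m. \<Sum>j<n. of_int (\<Sum>k\<le>D. c k * a k i j) * (y ^ i * z ^ j))"
    by (simp add: sum_distrib_right)
  also have "\<dots> = 0" using crel by (force simp: E_def intro: sum.neutral)
  finally have root: "ipoly p w = 0" .
  have DS: "D \<le> S\<^sup>2" unfolding D_def power2_eq_square using assms by (intro mult_mono) auto
  have "S\<^sup>2 \<le> op_bound S"
  proof -
    have "S\<^sup>2 * 1 * 1 \<le> S\<^sup>2 * (S\<^sup>2 + 1) * (2 * S + 3)" by (intro mult_mono) auto
    then show ?thesis unfolding op_bound_def by simp
  qed
  with degp DS have degS: "degree p \<le> op_bound S" by linarith
  have "\<bar>coeff p k\<bar> \<le> 2 ^ op_bound S" for k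
  proof (cases "k \<le> D")
    case True
    have "2 * (D + 1) * A \<le> 2 * 2 ^ D * A" by (intro mult_mono) (auto simp: Suc_le_eq)
    also have "\<dots> = 2 ^ (1 + D * (2 * S + 3))" unfolding A_def
      by (simp add: power_add[symmetric] algebra_simps)
    finally have "(2 * (D + 1) * A) ^ D \<le> (2 ^ (1 + D * (2 * S + 3))) ^ D" by (rule power_mono) simp
    also have "\<dots> = 2 ^ (D * (1 + D * (2 * S + 3)))"
      unfolding power_mult[symmetric] by (simp only: mult.commute)
    finally have "(2 * (D + 1) * A) ^ D \<le> (2::nat) ^ (D * (1 + D * (2 * S + 3)))" .
    then have "int ((2 * (D + 1) * A) ^ D) \<le> int (2 ^ (D * (1 + D * (2 * S + 3))))"
      by (simp only: of_nat_le_iff)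
    also have "\<dots> = 2 ^ (D * (1 + D * (2 * S + 3)))" by simp
    finally have "\<bar>c k\<bar> \<le> 2 ^ (D * (1 + D * (2 * S + 3)))"
      using c[OF True] by (rule order_trans[rotated])
    moreover have "\<bar>L\<bar> ^ k \<le> 2 ^ (D * (2 * S + 2))"
    proof -
      have "\<bar>L\<bar> ^ k \<le> K ^ k" using L by (intro power_mono) auto
      also have "\<dots> \<le> K ^ D" using True \<open>K \<ge> 1\<close> by (rule power_increasing)
      also have "\<dots> = 2 ^ (D * (2 * S + 2))"
        unfolding K power_mult[symmetric] by (simp only: mult.commute)
      finally show ?thesis .
    qed
    ultimately have "\<bar>coeff p k\<bar> \<le> 2 ^ (D * (1 + D * (2 * S + 3))) * 2 ^ (D * (2 * S + 2))"
      using True by (simp add: coeff_p abs_mult power_abs mult_mono)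
    also have "\<dots> = 2 ^ (D * (D + 1) * (2 * S + 3))"
      unfolding power_add[symmetric] by (simp add: algebra_simps)
    also have "\<dots> \<le> 2 ^ op_bound S"
    proof (rule power_increasing)
      have "D * (D + 1) * (2 * S + 3) \<le> S\<^sup>2 * (S\<^sup>2 + 1) * (2 * S + 3)"
        using DS by (intro mult_mono) auto
      then show "D * (D + 1) * (2 * S + 3) \<le> op_bound S" unfolding op_bound_def by linarith
    qed simp
    finally show ?thesis .
  qed (simp add: coeff_p)
  then show ?thesis unfolding bounded_root_def using \<open>p \<noteq> 0\<close> degS root by blast
qed

text \<open>The product \<open>L\<close> of the leading coefficients clears denominators for
  \<open>y\<close> and \<open>z\<close> together. Multiplication by \<open>L * (y + z)\<close> or
  \<open>L * (y - z)\<close> combines two scaled single steps, and by \<open>L * (y * z)\<close>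
  composes two steps; in each case the coefficients grow by the factor
  \<open>4 * H * H\<close>.\<close>

lemma bounded_root_arith:
  assumes "bounded_root S y" and "bounded_root S z"
  shows bounded_root_add: "bounded_root (op_bound S) (y + z)"
    and bounded_root_diff: "bounded_root (op_bound S) (y - z)"
    and bounded_root_mult: "bounded_root (op_bound S) (y * z)"
proof -
  obtain p where p: "p \<noteq> 0" "degree p \<le> S" "\<And>i. \<bar>coeff p i\<bar> \<le> 2 ^ S" "ipoly p y = 0"
    using assms(1) unfolding bounded_root_def by blast
  obtain q where q: "q \<noteq> 0" "degree q \<le> S" "\<And>i. \<bar>coeff q i\<bar> \<le> 2 ^ S" "ipoly q z = 0"
    using assms(2) unfolding bounded_root_def by blast
  have pos: "degree r > 0" if "r \<noteq> 0" "ipoly r x = 0" for r x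
    using that ipoly_altdef[of r 0 x] leading_coeff_neq_0[of r] by (intro Nat.gr0I) auto
  define m where "m = degree p"
  define n where "n = degree q"
  have mn: "m > 0" "n > 0" "m \<le> S" "n \<le> S" 
    using pos[OF p(1,4)] pos[OF q(1,4)] p(2) q(2) by (simp_all add: m_def n_def)
  define L where "L = lead_coeff p * lead_coeff q"
  define H where "H = (2::int) ^ S"
  define K where "K = (2::int) ^ (2 * S + 2)"
  have K: "K = 4 * H * H" unfolding K_def H_def mult_2 power_add by simp
  have L0: "L \<noteq> 0" using p(1) q(1) by (simp add: L_def)
  have "\<bar>L\<bar> \<le> H * H" unfolding L_def abs_mult H_def using p(3) q(3) by (intro mult_mono) simp_all
  moreover have "0 \<le> H * H" by simp
  ultimately have LK: "\<bar>L\<bar> \<le> K" unfolding K by linarith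
  have Y: "int_span m n y z (2 * H * B) (of_int (lead_coeff p) * y * x)"
    if "int_span m n y z B x" for B x
    using int_span_mult_root[OF p(4) _ mn(1) p(3) that] by (simp add: m_def H_def)
  have Z: "int_span m n y z (2 * H * B) (of_int (lead_coeff q) * z * x)"
    if "int_span m n y z B x" for B x
    using int_span_mult_root[OF q(4) _ mn(2) q(3), of m y B x] that
    unfolding int_span_swap[of m n] by (simp add: n_def H_def)
  \<comment> \<open>The parameter \<open>s\<close> is 1 or -1 and treats the sum and the difference
    at once.\<close>
  have sum: "int_span m n y z (K * B) (of_int L * (y + of_int s * z) * x)"
    if "int_span m n y z B x" "\<bar>s\<bar> = 1" for s B x
  proof -
    have "int_span m n y z (H * (2 * H * B)) (of_int (lead_coeff q) * (of_int (lead_coeff p) * y * x))"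
      by (rule int_span_scale[OF Y[OF that(1)]]) (simp add: q(3) H_def)
    moreover have "int_span m n y z (H * (2 * H * B))
        (of_int (s * lead_coeff p) * (of_int (lead_coeff q) * z * x))"
      by (rule int_span_scale[OF Z[OF that(1)]]) (simp add: p(3) H_def abs_mult that(2))
    ultimately have "int_span m n y z (H * (2 * H * B) + H * (2 * H * B))
        (of_int (lead_coeff q) * (of_int (lead_coeff p) * y * x)
          + of_int (s * lead_coeff p) * (of_int (lead_coeff q) * z * x))"
      by (rule int_span_add)
    then show ?thesis by (simp add: K L_def algebra_simps)
  qed
  have prod: "int_span m n y z (K * B) (of_int L * (y * z) * x)"
    if "int_span m n y z B x" for B x
    using Y[OF Z[OF that]] by (simp add: K L_def ac_simps)
  note fin = bounded_root_of_int_span[OF mn L0 LK K_def]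
  show "bounded_root (op_bound S) (y + z)" by (rule fin) (use sum[of _ _ 1] in simp)
  show "bounded_root (op_bound S) (y - z)" by (rule fin) (use sum[of _ _ "-1"] in simp)
  show "bounded_root (op_bound S) (y * z)" by (rule fin) (rule prod)
qed

section \<open>Size of standard representations\<close>

lemma bounded_root_imp_algebraic:
  assumes "bounded_root S z"
  shows "algebraic z"
proof -
  obtain p where "p \<noteq> 0" "ipoly p z = 0" using assms unfolding bounded_root_def by blast
  then show ?thesis
    by (intro algebraicI[of "map_poly of_int p"]) (auto simp: coeff_map_poly map_poly_eq_0_iff)
qed

lemma ipoly_add: "ipoly (p + q) z = ipoly p z + ipoly q z"
proof -
  have "map_poly of_int (p + q) = map_poly of_int p + (map_poly of_int q :: complex poly)"
    by (rule poly_eqI) (simp add: coeff_map_poly)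
  then show ?thesis by simp
qed

lemma map_poly_of_int_mult:
  "map_poly of_int (p * q) = map_poly of_int p * (map_poly of_int q :: complex poly)"
  by (rule poly_eqI) (simp add: coeff_map_poly coeff_mult)

text \<open>Pseudo-division stays within the integers. The remainder vanishes at \<open>z\<close>
  and is zero by minimality of the degree; since \<open>p\<close> is primitive, Gauss's lemma lets
  the factor \<open>a\<close> be cancelled from the quotient.\<close>

lemma defining_poly_dvd:
  assumes p: "defining_poly p z" and q: "ipoly q z = 0"
  shows "p dvd q"
proof -
  have p0: "p \<noteq> 0" "ipoly p z = 0" "content p = 1"
    and least: "\<And>r. r \<noteq> 0 \<Longrightarrow> ipoly r z = 0 \<Longrightarrow> degree p \<le> degree r"
    using p unfolding defining_poly_def by auto
  define r where "r = pseudo_mod q p"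
  obtain a s where as: "a \<noteq> 0" "smult a q = p * s + r"
    using pseudo_mod(1)[OF p0(1), of q] unfolding r_def by blast
  have r: "r = 0 \<or> degree r < degree p" using pseudo_mod(2)[OF p0(1), of q] unfolding r_def .
  have "ipoly (smult a q) z = 0" using q by (simp add: map_poly_smult)
  then have "ipoly r z = 0" unfolding as(2) by (simp add: ipoly_add map_poly_of_int_mult p0)
  then have "r = 0" using r least[of r] by fastforce
  then have eq: "smult a q = p * s" using as by simp
  have "a dvd content s"
    using arg_cong[OF eq, of content] p0(3) by (simp add: content_mult) (metis abs_dvd_iff dvd_triv_left)
  then have "[:a:] dvd s" by (simp add: const_poly_dvd_iff_dvd_content)
  then obtain s' where "s = [:a:] * s'" by blast
  then have "smult a q = smult a (p * s')" using eq by simp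
  then have "q = p * s'" using as(1) by (metis smult_cancel)
  then show ?thesis by simp
qed

section \<open>Bounds for roots and for coefficients of factors\<close>

text \<open>Cauchy's root bound: a nonzero integer leading coefficient has modulus at least 1, so
  for larger \<open>z\<close> the leading term exceeds the geometric sum that bounds all
  others.\<close>

lemma cmod_root_le:
  fixes p :: "int poly" and H :: real
  assumes "p \<noteq> 0" and H: "\<And>i. \<bar>of_int (coeff p i)\<bar> \<le> H" and root: "ipoly p z = 0"
  shows "cmod z \<le> 1 + H"
proof (rule ccontr)
  assume "\<not> ?thesis"
  moreover have "0 \<le> H" using H[of 0] by linarith
  ultimately have z: "cmod z > 1" "cmod z - 1 > H" by auto
  define n where "n = degree p"
  define L where "L = lead_coeff p"
  have "\<bar>L\<bar> \<ge> 1" using \<open>p \<noteq> 0\<close> by (simp add: L_def int_one_le_iff_zero_less)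
  then have L1: "\<bar>real_of_int L\<bar> \<ge> 1" by linarith
  have "ipoly p z = (\<Sum>i<n. of_int (coeff p i) * z ^ i) + of_int L * z ^ n"
    by (simp add: ipoly_altdef[OF order_refl] lessThan_Suc_atMost[symmetric] L_def n_def)
  then have "of_int L * z ^ n = - (\<Sum>i<n. of_int (coeff p i) * z ^ i)"
    using root by (simp add: eq_neg_iff_add_eq_0 add.commute)
  then have "cmod (of_int L * z ^ n) = cmod (\<Sum>i<n. of_int (coeff p i) * z ^ i)" by simp
  also have "\<dots> \<le> (\<Sum>i<n. H * cmod z ^ i)"
    by (rule sum_norm_le) (simp add: norm_mult norm_power H mult_right_mono)
  also have "\<dots> = H * ((cmod z ^ n - 1) / (cmod z - 1))"
    using z by (simp add: sum_distrib_left[symmetric] geometric_sum)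
  finally have "cmod (of_int L * z ^ n) * (cmod z - 1) \<le> H * (cmod z ^ n - 1)"
    using z by (simp add: field_simps)
  moreover have "cmod z ^ n * (cmod z - 1) \<le> cmod (of_int L * z ^ n) * (cmod z - 1)"
    using L1 z mult_right_mono[OF L1, of "cmod z ^ n"]
    by (intro mult_right_mono) (auto simp: norm_mult norm_power)
  moreover have "cmod z ^ n * H < cmod z ^ n * (cmod z - 1)"
    using z by (intro mult_strict_left_mono zero_less_power) auto
  ultimately show False using \<open>0 \<le> H\<close> by (simp add: algebra_simps)
qed

lemma bounded_root_cmod_le:
  assumes "bounded_root S z"
  shows "cmod z \<le> 1 + 2 ^ S"
proof -
  obtain p where p: "p \<noteq> 0" "\<And>i. \<bar>coeff p i\<bar> \<le> 2 ^ S" "ipoly p z = 0"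
    using assms unfolding bounded_root_def by blast
  have "\<bar>real_of_int (coeff p i)\<bar> \<le> 2 ^ S" for i
    using p(2)[of i] by (metis of_int_abs of_int_le_iff of_int_numeral of_int_power)
  then show ?thesis using cmod_root_le p by blast
qed

text \<open>Reversing the coefficients respects both bounds. This turns the upper bound for roots
  into a lower bound for nonzero roots, which later separates conjugates.\<close>

lemma bounded_root_inverse:
  assumes "bounded_root S z" and "z \<noteq> 0"
  shows "bounded_root S (inverse z)"
proof -
  obtain p where p: "p \<noteq> 0" "degree p \<le> S" "\<And>i. \<bar>coeff p i\<bar> \<le> 2 ^ S" "ipoly p z = 0"
    using assms unfolding bounded_root_def by blast
  have "map_poly of_int (reflect_poly p) = reflect_poly (map_poly of_int p :: complex poly)"
    by (rule poly_eqI) (simp add: coeff_map_poly coeff_reflect_poly degree_map_poly)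
  then have "ipoly (reflect_poly p) (inverse z) = 0"
    using p(4) \<open>z \<noteq> 0\<close> by (simp add: poly_reflect_poly_nz)
  moreover have "\<bar>coeff (reflect_poly p) i\<bar> \<le> 2 ^ S" for i
    using p(3) by (simp add: coeff_reflect_poly)
  ultimately show ?thesis
    unfolding bounded_root_def using p degree_reflect_poly_le[of p]
    by (intro exI[of _ "reflect_poly p"]) auto
qed

lemma bounded_root_cmod_ge:
  assumes "bounded_root S z" and "z \<noteq> 0"
  shows "1 / 2 ^ (S + 1) \<le> cmod z"
proof -
  have "inverse (cmod z) \<le> 1 + 2 ^ S"
    using bounded_root_cmod_le[OF bounded_root_inverse[OF assms]] by (simp add: norm_inverse)
  also have "\<dots> \<le> 2 ^ (S + 1)" using one_le_power[of "2::real" S] by simp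
  finally show ?thesis using assms(2) by (simp add: field_simps)
qed

text \<open>Splitting off a linear factor with root \<open>a\<close> changes the coefficient bound
  from \<open>M\<close> to at most \<open>M + R * M\<close>. The lemma plays the role of the
  Landau-Mignotte bound for factors.\<close>

lemma cmod_coeff_le:
  fixes p :: "complex poly"
  assumes "\<And>w. poly p w = 0 \<Longrightarrow> cmod w \<le> R" and "R \<ge> 0"
  shows "cmod (coeff p i) \<le> cmod (lead_coeff p) * (1 + R) ^ degree p"
  using assms(1)
proof (induction "degree p" arbitrary: p i)
  case 0
  then show ?case by (cases i) (auto simp: coeff_eq_0)
next
  case (Suc n)
  then have "\<not> constant (poly p)" by (simp add: constant_degree)
  then obtain a where a: "poly p a = 0" using fundamental_theorem_of_algebra by blast
  then obtain q where q: "p = [:- a, 1:] * q" unfolding poly_eq_0_iff_dvd by blast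
  have "p \<noteq> 0" using Suc(2) by auto
  then have "q \<noteq> 0" using q by auto
  have deg: "degree p = Suc (degree q)" unfolding q
    using \<open>q \<noteq> 0\<close> by (subst degree_mult_eq) auto
  have lc: "lead_coeff p = lead_coeff q" unfolding q lead_coeff_mult by simp
  define M where "M = cmod (lead_coeff q) * (1 + R) ^ degree q"
  have IH: "cmod (coeff q i) \<le> M" for i
    unfolding M_def using Suc(2) deg Suc.prems by (intro Suc.hyps(1)) (auto simp: q)
  have "M \<ge> 0" using \<open>R \<ge> 0\<close> by (simp add: M_def)
  have "coeff p i = (if i = 0 then 0 else coeff q (i - 1)) - a * coeff q i"
    unfolding q by (cases i) (auto simp: coeff_pCons)
  then have "cmod (coeff p i) \<le> cmod (if i = 0 then 0 else coeff q (i - 1)) + cmod (a * coeff q i)"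
    by (metis norm_triangle_ineq4)
  also have "\<dots> \<le> M + R * M"
    using IH \<open>M \<ge> 0\<close> Suc.prems[OF a] \<open>R \<ge> 0\<close> by (intro add_mono) (auto simp: norm_mult intro!: mult_mono)
  also have "\<dots> = cmod (lead_coeff p) * (1 + R) ^ degree p"
    using lc by (simp add: M_def deg algebra_simps)
  finally show ?case .
qed

section \<open>Bit lengths and small standard representations\<close>

text \<open>One extra unit is the sign bit, the other arises because \<open>2 ^ m\<close> itself has
  \<open>m + 1\<close> binary digits.\<close>

lemma int_size_le:
  assumes "\<bar>k\<bar> \<le> 2 ^ m"
  shows "int_size k \<le> m + 2"
proof -
  have "nat \<bar>k\<bar> < 2 ^ (m + 1)"
    using assms by (simp add: nat_less_iff) (smt (verit) zero_less_power)
  then have "floorlog 2 (nat \<bar>k\<bar>) \<le> m + 1" by (intro floorlog_leI) auto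
  then show ?thesis by (simp add: int_size_def)
qed

lemma int_size_mono: "\<bar>k\<bar> \<le> \<bar>l\<bar> \<Longrightarrow> int_size k \<le> int_size l"
  by (simp add: int_size_def floorlog_mono)

lemma abs_le_int_size: "\<bar>k\<bar> \<le> 2 ^ int_size k"
proof -
  have "\<bar>k\<bar> < 2 ^ floorlog 2 (nat \<bar>k\<bar>)" if "k \<noteq> 0"
    using that floorlog_bounds[of "nat \<bar>k\<bar>" 2] by simp
  then show ?thesis by (cases "k = 0") (auto simp: int_size_def)
qed

lemma rat_size_Fract_le:
  assumes "n > 0"
  shows "rat_size (Fract m n) \<le> int_size m + int_size n"
proof -
  define g where "g = gcd m n"
  have "g > 0" using assms by (simp add: g_def)
  have *: "\<bar>k div g\<bar> \<le> \<bar>k\<bar>" if dvd: "g dvd k" for k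
  proof -
    obtain l where "k = g * l" using dvd by blast
    moreover have "1 * \<bar>l\<bar> \<le> g * \<bar>l\<bar>" using \<open>g > 0\<close> by (intro mult_right_mono) auto
    ultimately show ?thesis using \<open>g > 0\<close> by (simp add: abs_mult)
  qed
  have "quotient_of (Fract m n) = (m div g, n div g)"
    using assms by (simp add: quotient_of_Fract Rat.normalize_def Let_def g_def)
  then show ?thesis unfolding rat_size_def
    using *[of m] *[of n] by (auto simp: g_def intro!: add_mono int_size_mono)
qed

lemma sum_list_map_le:
  fixes f :: "'a \<Rightarrow> nat"
  assumes "\<And>x. x \<in> set xs \<Longrightarrow> f x \<le> K"
  shows "(\<Sum>x\<leftarrow>xs. f x) \<le> length xs * K"
  using sum_list_mono[of xs f "\<lambda>_. K"] assms by (simp add: sum_list_triv)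

text \<open>The product bounds the defining polynomial. With \<open>T = op_bound S\<close>, each
  centre coordinate costs at most \<open>2 * T + S + 12\<close> and the radius at most
  \<open>T + 8\<close>, which gives the remaining summands.\<close>

definition rep_bound :: "nat \<Rightarrow> nat"
  where "rep_bound S = (S + 1) * (S + S * (S + 2) + 2) + 5 * op_bound S + 2 * S + 32"

text \<open>The defining polynomial divides the small annihilating polynomial \<open>q\<close>.
  Hence its leading coefficient is no larger than that of \<open>q\<close> and its roots obey
  Cauchy's bound for \<open>q\<close>; these two data control every coefficient.\<close>

lemma poly_size_defining_poly_le:
  assumes "bounded_root S z" and p: "defining_poly p z"
  shows "poly_size p \<le> (S + 1) * (S + S * (S + 2) + 2)"
proof -
  obtain q where q: "q \<noteq> 0" "degree q \<le> S" "\<And>i. \<bar>coeff q i\<bar> \<le> 2 ^ S" "ipoly q z = 0"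
    using assms unfolding bounded_root_def by blast
  have "p dvd q" using defining_poly_dvd p q by blast
  have deg: "degree p \<le> S" using dvd_imp_degree_le[OF \<open>p dvd q\<close>] q by simp
  obtain s where s: "q = p * s" using \<open>p dvd q\<close> by blast
  have "\<bar>lead_coeff p\<bar> \<le> \<bar>lead_coeff q\<bar>"
  proof -
    have "lead_coeff s \<noteq> 0" using s q by auto
    then have "\<bar>lead_coeff s\<bar> \<ge> 1" by linarith
    then show ?thesis unfolding s lead_coeff_mult abs_mult
      using mult_left_mono[of 1 "\<bar>lead_coeff s\<bar>" "\<bar>lead_coeff p\<bar>"] by simp
  qed
  then have lc: "\<bar>lead_coeff p\<bar> \<le> 2 ^ S" using q(3) order_trans by blast
  have "\<bar>coeff p i\<bar> \<le> 2 ^ (S + S * (S + 2))" for i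
  proof -
    define R :: real where "R = 1 + 2 ^ S"
    have "R \<ge> 0" by (simp add: R_def)
    have "cmod w \<le> R" if "ipoly p w = 0" for w
    proof -
      have "ipoly q w = 0" unfolding s using that by (simp add: map_poly_of_int_mult)
      then have "bounded_root S w" unfolding bounded_root_def using q by blast
      then show ?thesis unfolding R_def by (rule bounded_root_cmod_le)
    qed
    from cmod_coeff_le[of "map_poly of_int p" R i, OF this \<open>R \<ge> 0\<close>]
    have "\<bar>real_of_int (coeff p i)\<bar> \<le> \<bar>real_of_int (lead_coeff p)\<bar> * (1 + R) ^ degree p"
      by (simp add: coeff_map_poly degree_map_poly)
    also have "\<dots> \<le> 2 ^ S * (2 ^ (S + 2)) ^ S"
    proof (rule mult_mono)
      show "\<bar>real_of_int (lead_coeff p)\<bar> \<le> 2 ^ S"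
        using lc by (metis of_int_abs of_int_le_iff of_int_numeral of_int_power)
      have "(1 + R) ^ degree p \<le> (1 + R) ^ S" using deg \<open>R \<ge> 0\<close> by (intro power_increasing) auto
      also have "\<dots> \<le> (2 ^ (S + 2)) ^ S"
      proof (rule power_mono)
        have "(1::real) \<le> 2 ^ S" by (rule one_le_power) simp
        then have "1 + R \<le> 2 ^ S * 4" unfolding R_def by linarith
        then show "1 + R \<le> 2 ^ (S + 2)" by (simp add: power_add)
      qed (use \<open>R \<ge> 0\<close> in simp)
      finally show "(1 + R) ^ degree p \<le> (2 ^ (S + 2)) ^ S" .
    qed (use \<open>R \<ge> 0\<close> in auto)
    also have "\<dots> = 2 ^ (S + S * (S + 2))"
      unfolding power_mult[symmetric] power_add[symmetric] by (simp only: mult.commute)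
    finally show ?thesis
      by (metis of_int_abs of_int_le_iff of_int_numeral of_int_power)
  qed
  then have "int_size (coeff p i) \<le> S + S * (S + 2) + 2" for i by (rule int_size_le)
  then have "int_size c \<le> S + S * (S + 2) + 2" if "c \<in> set (coeffs p)" for c
    using that unfolding coeffs_def by (force split: if_splits)
  then have "poly_size p \<le> length (coeffs p) * (S + S * (S + 2) + 2)"
    unfolding poly_size_def by (rule sum_list_map_le)
  also have "\<dots> \<le> (S + 1) * (S + S * (S + 2) + 2)"
    using deg by (intro mult_right_mono) (auto simp: coeffs_def)
  finally show ?thesis .
qed

text \<open>The difference of two roots of the defining polynomial is again a bounded root, so
  distinct roots are far apart. Rounding \<open>z\<close> to a grid finer than this distance gives
  the centre of an isolating disc.\<close>

lemma ex_small_representation: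
  assumes "bounded_root S z"
  shows "\<exists>R. represents R z \<and> rep_size R \<le> rep_bound S"
proof -
  obtain p where p: "defining_poly p z"
    using ex_defining_poly bounded_root_imp_algebraic[OF assms] by blast
  define T where "T = op_bound S"
  \<comment> \<open>The separation \<open>1 / 2 ^ (T + 1)\<close> equals \<open>4 / N\<close>. A
    disc of radius \<open>2 / N\<close> therefore cannot contain two roots, while rounding both
    coordinates moves \<open>z\<close> by less than \<open>2 / N\<close>.\<close>
  define N :: int where "N = 2 ^ (T + 3)"
  have "N > 0" by (simp add: N_def)
  have sep: "4 / of_int N \<le> cmod (w - z)" if w: "ipoly p w = 0" "w \<noteq> z" for w
  proof -
    obtain q where q: "q \<noteq> 0" "degree q \<le> S" "\<And>i. \<bar>coeff q i\<bar> \<le> 2 ^ S" "ipoly q z = 0"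
      using assms unfolding bounded_root_def by blast
    obtain s where "q = p * s" using defining_poly_dvd[OF p q(4)] by blast
    then have "ipoly q w = 0" using w by (simp add: map_poly_of_int_mult)
    then have "bounded_root S w" unfolding bounded_root_def using q by blast
    then have "bounded_root T (w - z)" unfolding T_def using assms by (rule bounded_root_diff)
    then have "1 / 2 ^ (T + 1) \<le> cmod (w - z)" using w by (intro bounded_root_cmod_ge) auto
    then show ?thesis by (simp add: N_def power_add)
  qed
  define a where "a = \<lfloor>of_int N * Re z\<rfloor>"
  define b where "b = \<lfloor>of_int N * Im z\<rfloor>"
  define R where "R = Alg_Rep p (Fract a N) (Fract b N) (Fract 2 N)"
  define c where "c = Complex (of_int a / of_int N) (of_int b / of_int N)"
  have near: "\<bar>x - of_int \<lfloor>of_int N * x\<rfloor> / of_int N\<bar> < 1 / of_int N" for x :: real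
  proof -
    have "of_int N * \<bar>x - of_int \<lfloor>of_int N * x\<rfloor> / of_int N\<bar> = \<bar>of_int N * x - of_int \<lfloor>of_int N * x\<rfloor>\<bar>"
      using \<open>N > 0\<close> by (simp add: abs_mult_pos' right_diff_distrib)
    also have "\<dots> < 1" by linarith
    finally show ?thesis using \<open>N > 0\<close> by (simp add: field_simps)
  qed
  have "cmod (z - c) \<le> \<bar>Re (z - c)\<bar> + \<bar>Im (z - c)\<bar>" by (rule cmod_le)
  also have "\<dots> < 1 / of_int N + 1 / of_int N"
    unfolding c_def using near[of "Re z"] near[of "Im z"] by (intro add_strict_mono) (auto simp: a_def b_def)
  finally have zc: "cmod (z - c) < 2 / of_int N" by simp
  have disc: "rep_disc R = {w. cmod (w - c) < 2 / of_int N}"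
    using \<open>N > 0\<close> by (simp add: rep_disc_def R_def c_def of_rat_rat)
  have "w = z" if "ipoly p w = 0" "cmod (w - c) < 2 / of_int N" for w
  proof (rule ccontr)
    assume "w \<noteq> z"
    then have "4 / of_int N \<le> cmod (w - z)" using sep that by blast
    also have "\<dots> \<le> cmod (w - c) + cmod (z - c)"
      using norm_triangle_ineq4[of "w - c" "z - c"] by simp
    finally show False using that zc by simp
  qed
  moreover have "ipoly p z = 0" using p by (simp add: defining_poly_def)
  ultimately have "{w. ipoly p w = 0} \<inter> rep_disc R = {z}" unfolding disc using zc by blast
  then have rep: "represents R z" using p by (simp add: represents_def R_def)
  have num: "\<bar>\<lfloor>of_int N * x\<rfloor>\<bar> \<le> 2 ^ (T + S + 5)" if "\<bar>x\<bar> \<le> cmod z" for x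
  proof -
    have "\<bar>x\<bar> \<le> 1 + 2 ^ S" using that bounded_root_cmod_le[OF assms] by simp
    also have "\<dots> \<le> 2 ^ (S + 1)" using one_le_power[of "2::real" S] by simp
    finally have "of_int N * \<bar>x\<bar> \<le> of_int N * 2 ^ (S + 1)" using \<open>N > 0\<close> by (intro mult_left_mono) auto
    also have "\<dots> = 2 ^ (T + S + 4)" by (simp add: N_def power_add)
    finally have "\<bar>of_int N * x\<bar> \<le> 2 ^ (T + S + 4)" using \<open>N > 0\<close> by (simp add: abs_mult)
    moreover have "(1::real) \<le> 2 ^ (T + S + 4)" by (rule one_le_power) simp
    ultimately have "of_int \<bar>\<lfloor>of_int N * x\<rfloor>\<bar> \<le> (2::real) ^ (T + S + 5)"
      unfolding power_Suc[of 2 "T + S + 4", simplified] by (simp add: power_add) linarith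
    then show ?thesis by (metis of_int_le_iff of_int_numeral of_int_power)
  qed
  have "int_size N \<le> T + 5" using int_size_le[of N "T + 3"] by (simp add: N_def)
  moreover have "int_size a \<le> T + S + 7" "int_size b \<le> T + S + 7"
    using int_size_le[OF num[of "Re z"]] int_size_le[OF num[of "Im z"]]
    by (simp_all add: a_def b_def abs_Re_le_cmod abs_Im_le_cmod)
  moreover have "int_size 2 \<le> 3" using int_size_le[of 2 1] by simp
  moreover note rat_size_Fract_le[OF \<open>N > 0\<close>, of a] rat_size_Fract_le[OF \<open>N > 0\<close>, of b]
    rat_size_Fract_le[OF \<open>N > 0\<close>, of 2] poly_size_defining_poly_le[OF assms p]
  ultimately have "rep_size R \<le> rep_bound S"
    unfolding rep_size_def R_def rep_bound_def T_def by simp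
  with rep show ?thesis by blast
qed

text \<open>The defining polynomial is itself the witness. Its sign bits alone make the size at
  least the number of coefficients, which bounds the degree.\<close>

lemma represents_imp_bounded_root:
  assumes "represents R z" and "rep_size R \<le> S"
  shows "bounded_root S z"
proof -
  define p where "p = rep_poly R"
  have p: "p \<noteq> 0" "ipoly p z = 0"
    using assms unfolding represents_def defining_poly_def p_def by auto
  have size: "poly_size p \<le> S" using assms unfolding rep_size_def p_def by simp
  have "length (coeffs p) \<le> poly_size p"
    unfolding poly_size_def int_size_def sum_list_addf by (simp add: sum_list_triv)
  then have "degree p \<le> S" using p size by (simp add: length_coeffs)
  moreover have "\<bar>coeff p i\<bar> \<le> 2 ^ S" for i
  proof (cases "i \<le> degree p")
    case True
    then have "coeff p i \<in> set (coeffs p)" using p by (intro coeff_in_coeffs)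
    then have "int_size (coeff p i) \<le> poly_size p"
      unfolding poly_size_def by (intro member_le_sum_list) auto
    then have "(2::int) ^ int_size (coeff p i) \<le> 2 ^ S" using size by (intro power_increasing) auto
    then show ?thesis using abs_le_int_size[of "coeff p i"] by linarith
  qed (simp add: coeff_eq_0)
  ultimately show ?thesis unfolding bounded_root_def using p by blast
qed

section \<open>Fourier-Motzkin elimination\<close>

text \<open>Positive coefficients give lower bounds for \<open>x\<close>, negative ones upper
  bounds, and a solution exists when every lower bound is below every upper bound.
  Cross-multiplication keeps the conditions polynomial in the data.\<close>

lemma fourier_motzkin:
  fixes p q :: "'a \<Rightarrow> real"
  assumes "finite J"
  shows "(\<exists>x. \<forall>j\<in>J. 0 \<le> p j + x * q j) \<longleftrightarrow>
    (\<forall>j\<in>J. q j = 0 \<longrightarrow> 0 \<le> p j) \<and>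
    (\<forall>j\<in>J. \<forall>k\<in>J. 0 < q j \<and> q k < 0 \<longrightarrow> 0 \<le> q j * p k - q k * p j)"
    (is "?L \<longleftrightarrow> ?R")
proof
  assume ?L
  then obtain x where x: "\<And>j. j \<in> J \<Longrightarrow> 0 \<le> p j + x * q j" by blast
  have "0 \<le> q j * p k - q k * p j" if "j \<in> J" "k \<in> J" "0 < q j" "q k < 0" for j k
  proof -
    have "0 \<le> q j * (p k + x * q k)" "0 \<le> - q k * (p j + x * q j)"
      using x that by (auto intro!: mult_nonneg_nonneg simp: mult_nonpos_nonneg)
    then show ?thesis by (simp add: algebra_simps)
  qed
  moreover have "0 \<le> p j" if "j \<in> J" "q j = 0" for j using x[OF that(1)] that by simp
  ultimately show ?R by blast
next
  assume R: ?R
  define lo where "lo = (\<lambda>j. - p j / q j) ` {j \<in> J. 0 < q j}"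
  define up where "up = (\<lambda>j. - p j / q j) ` {j \<in> J. q j < 0}"
  have fin: "finite lo" "finite up" using assms by (auto simp: lo_def up_def)
  have "l \<le> u" if l: "l \<in> lo" and u: "u \<in> up" for l u
  proof -
    obtain j k where jk: "j \<in> J" "0 < q j" "l = - p j / q j" "k \<in> J" "q k < 0" "u = - p k / q k"
      using l u unfolding lo_def up_def by blast
    then have "0 \<le> q j * p k - q k * p j" using R by blast
    then show ?thesis using jk(2,5) unfolding jk(3,6) by (simp add: field_simps)
  qed
  \<comment> \<open>The witness is the largest lower bound, or the least upper bound if there are no
    lower bounds, or arbitrary if there are neither.\<close>
  then obtain x where x: "\<And>l. l \<in> lo \<Longrightarrow> l \<le> x" "\<And>u. u \<in> up \<Longrightarrow> x \<le> u"
  proof (cases "lo = {}")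
    case True
    show ?thesis
    proof (cases "up = {}")
      case False
      then show ?thesis using True fin by (intro that[of "Min up"]) auto
    qed (use True that in auto)
  next
    case False
    assume "\<And>l u. l \<in> lo \<Longrightarrow> u \<in> up \<Longrightarrow> l \<le> u"
    with False show ?thesis using fin by (intro that[of "Max lo"]) auto
  qed
  have "0 \<le> p j + x * q j" if "j \<in> J" for j
  proof (cases "q j" "0::real" rule: linorder_cases)
    case less
    then have "x \<le> - p j / q j" using x(2) that by (auto simp: up_def)
    then show ?thesis using less by (simp add: field_simps)
  next
    case equal
    then show ?thesis using R that by simp
  next
    case greater
    then have "- p j / q j \<le> x" using x(1) that by (auto simp: lo_def)
    then show ?thesis using greater by (simp add: field_simps)
  qed
  then show ?L by blast
qed

section \<open>Counting ring operations applied to the input\<close>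

text \<open>Here \<open>m\<close> is a budget of nested ring operations, each paid for by one
  application of \<open>op_bound\<close>, while \<open>S\<close> stays the size of the input. A
  fixed \<open>m\<close> thus means a polynomial bound in \<open>S\<close>.\<close>

definition level :: "nat \<Rightarrow> nat \<Rightarrow> complex \<Rightarrow> bool"
  where "level m S z \<longleftrightarrow> bounded_root ((op_bound ^^ m) S) z"

lemma level_Suc: "level m S z \<Longrightarrow> level (Suc m) S z"
  unfolding level_def using bounded_root_mono le_op_bound by fastforce

lemma level_mono:
  assumes "level m S z" and "m \<le> m'"
  shows "level m' S z"
  using assms(2,1) by (induction rule: dec_induct) (auto intro: level_Suc)

lemma level_add: "level m S y \<Longrightarrow> level m S z \<Longrightarrow> level (Suc m) S (y + z)"
  by (simp add: level_def bounded_root_add)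

lemma level_diff: "level m S y \<Longrightarrow> level m S z \<Longrightarrow> level (Suc m) S (y - z)"
  by (simp add: level_def bounded_root_diff)

lemma level_mult: "level m S y \<Longrightarrow> level m S z \<Longrightarrow> level (Suc m) S (y * z)"
  by (simp add: level_def bounded_root_mult)

lemma level_cnj: "level m S z \<Longrightarrow> level m S (cnj z)"
  by (simp add: level_def bounded_root_cnj)

lemma level_0_1:
  assumes "1 \<le> S"
  shows "level m S 0" and "level m S 1"
proof -
  have "level 0 S 0" "level 0 S 1"
    using bounded_root_mono[OF bounded_root_0_1(1) assms] bounded_root_mono[OF bounded_root_0_1(2) assms]
    by (simp_all add: level_def)
  then show "level m S 0" "level m S 1" by (auto intro: level_mono)
qed

lemma level_minus:
  assumes "level m S z" and "1 \<le> S"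
  shows "level (Suc m) S (- z)"
  using level_diff[OF level_0_1(1)[OF assms(2)] assms(1)] by simp

text \<open>A linear constraint is a coefficient vector paired with \<open>unknowns\<close>: its entries are the
  coefficients of \<open>\<nu>\<close>, of \<open>\<mu>\<close>, of \<open>\<lambda>\<alpha>\<^sup>n\<close>, \<open>\<lambda>\<rho>\<^sup>n\<close>, \<open>\<lambda>\<close> and of \<open>\<alpha>\<^sup>n\<close>, \<open>\<rho>\<^sup>n\<close>, \<open>1\<close>. Taking twice the real
  part accounts for the conjugate terms.\<close>

definition vec :: "complex list \<Rightarrow> nat \<Rightarrow> complex"
  where "vec xs i = (if i < length xs then xs ! i else 0)"

definition unknowns :: "real \<Rightarrow> real \<Rightarrow> real \<Rightarrow> complex \<Rightarrow> complex \<Rightarrow> nat \<Rightarrow> complex"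
  where "unknowns \<nu> \<mu> l a z =
    vec [of_real \<nu>, of_real \<mu>, of_real (2 * l) * a, of_real l * z, of_real l, 2 * a, z, 1]"

definition pairing :: "(nat \<Rightarrow> complex) \<Rightarrow> (nat \<Rightarrow> complex) \<Rightarrow> real"
  where "pairing c x = Re (\<Sum>i<8. c i * x i)"

lemma unknowns_upd:
  "(unknowns \<nu> \<mu> l a z)(0 := of_real x) = unknowns x \<mu> l a z"
  "(unknowns \<nu> \<mu> l a z)(1 := of_real x) = unknowns \<nu> x l a z"
  by (auto simp: unknowns_def vec_def nth_Cons fun_eq_iff split: nat.splits)

lemma pairing_unknowns:
  "pairing c (unknowns \<nu> \<mu> l a z) = \<nu> * Re (c 0) + \<mu> * Re (c 1)
    + l * (2 * Re (c 2 * a) + Re (c 3 * z) + Re (c 4)) + (2 * Re (c 5 * a) + Re (c 6 * z) + Re (c 7))"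
proof -
  have "{..<8::nat} = {0,1,2,3,4,5,6,7}" by auto
  then show ?thesis
    by (simp add: pairing_def unknowns_def vec_def algebra_simps)
qed

lemma pairing_upd:
  assumes "e < 8"
  shows "pairing c (x(e := of_real t)) = pairing c (x(e := 0)) + t * Re (c e)"
proof -
  have "(\<Sum>i<8. c i * (x(e := y)) i) = c e * y + (\<Sum>i\<in>{..<8} - {e}. c i * x i)" for y
    using assms by (subst sum.remove[of _ e]) (auto intro!: sum.cong)
  then show ?thesis by (simp add: pairing_def)
qed

section \<open>Elimination of one unknown from a set of constraints\<close>

text \<open>In \<open>eliminate\<close> this is used with \<open>c e\<close> positive and
  \<open>d e\<close> negative, so it is a nonnegative combination of \<open>c\<close> and
  \<open>d\<close> in which entry \<open>e\<close> cancels.\<close>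

definition combine :: "nat \<Rightarrow> (nat \<Rightarrow> complex) \<Rightarrow> (nat \<Rightarrow> complex) \<Rightarrow> nat \<Rightarrow> complex"
  where "combine e c d = (\<lambda>i. c e * d i - d e * c i)"

lemma pairing_combine:
  assumes "c e \<in> \<real>" and "d e \<in> \<real>"
  shows "pairing (combine e c d) x = Re (c e) * pairing d x - Re (d e) * pairing c x"
proof -
  have "(\<Sum>i<8. combine e c d i * x i) = c e * (\<Sum>i<8. d i * x i) - d e * (\<Sum>i<8. c i * x i)"
    by (simp add: combine_def left_diff_distrib sum_subtractf sum_distrib_left mult.assoc)
  then show ?thesis using assms by (simp add: pairing_def complex_is_Real_iff)
qed

definition eliminate :: "nat \<Rightarrow> (nat \<Rightarrow> complex) set \<Rightarrow> (nat \<Rightarrow> complex) set"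
  where "eliminate e J = {c \<in> J. c e = 0} \<union>
    (\<lambda>(c, d). combine e c d) ` {(c, d) \<in> J \<times> J. 0 < Re (c e) \<and> Re (d e) < 0}"

lemma eliminate_finite:
  assumes "finite J"
  shows "finite (eliminate e J)"
  unfolding eliminate_def using assms
  by (intro finite_UnI finite_imageI) (auto intro: finite_subset[of _ "J \<times> J"])

lemma card_eliminate_le:
  assumes "finite J" and "card J \<le> k"
  shows "card (eliminate e J) \<le> k + k\<^sup>2"
proof -
  define A where "A = {c \<in> J. c e = 0}"
  define B where "B = {(c, d) \<in> J \<times> J. 0 < Re (c e) \<and> Re (d e) < 0}"
  have "B \<subseteq> J \<times> J" by (auto simp: B_def)
  then have "finite B" using assms by (meson finite_SigmaI finite_subset)
  have "card A \<le> k" using card_mono[OF assms(1), of A] assms(2) by (auto simp: A_def)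
  moreover have "card B \<le> k\<^sup>2"
  proof -
    have "card B \<le> card (J \<times> J)" using assms \<open>B \<subseteq> J \<times> J\<close> by (intro card_mono) auto
    also have "\<dots> \<le> k\<^sup>2" using assms(2) by (simp add: card_cartesian_product power2_eq_square mult_mono)
    finally show ?thesis .
  qed
  moreover have "card (eliminate e J) \<le> card A + card ((\<lambda>(c, d). combine e c d) ` B)"
    unfolding eliminate_def A_def B_def by (rule card_Un_le)
  moreover have "card ((\<lambda>(c, d). combine e c d) ` B) \<le> card B" using \<open>finite B\<close> by (rule card_image_le)
  ultimately show ?thesis by linarith
qed

text \<open>Fourier-Motzkin with the pairing at \<open>x(e := 0)\<close> as constant part and
  \<open>Re (c e)\<close> as coefficient. Reality of entry \<open>e\<close> makes the complex test
  \<open>c e = 0\<close> agree with the real one.\<close>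

lemma eliminate_iff:
  assumes "finite J" and real: "\<And>c. c \<in> J \<Longrightarrow> c e \<in> \<real>" and "e < 8"
  shows "(\<exists>t::real. \<forall>c\<in>J. 0 \<le> pairing c (x(e := of_real t))) \<longleftrightarrow>
    (\<forall>c\<in>eliminate e J. 0 \<le> pairing c (x(e := 0)))"
proof -
  have "c e = 0 \<longleftrightarrow> Re (c e) = 0" if "c \<in> J" for c
    using real[OF that] by (simp add: complex_is_Real_iff complex_eq_iff)
  then have "(\<forall>c\<in>eliminate e J. 0 \<le> pairing c (x(e := 0))) \<longleftrightarrow>
      (\<forall>c\<in>J. Re (c e) = 0 \<longrightarrow> 0 \<le> pairing c (x(e := 0))) \<and>
      (\<forall>c\<in>J. \<forall>d\<in>J. 0 < Re (c e) \<and> Re (d e) < 0 \<longrightarrow> 0 \<le> pairing (combine e c d) (x(e := 0)))"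
    unfolding eliminate_def by auto
  also have "\<dots> \<longleftrightarrow> (\<forall>c\<in>J. Re (c e) = 0 \<longrightarrow> 0 \<le> pairing c (x(e := 0))) \<and>
      (\<forall>c\<in>J. \<forall>d\<in>J. 0 < Re (c e) \<and> Re (d e) < 0 \<longrightarrow>
        0 \<le> Re (c e) * pairing d (x(e := 0)) - Re (d e) * pairing c (x(e := 0)))"
    by (simp add: pairing_combine[OF real real])
  also have "\<dots> \<longleftrightarrow> (\<exists>t. \<forall>c\<in>J. 0 \<le> pairing c (x(e := 0)) + t * Re (c e))"
    by (rule fourier_motzkin[OF assms(1), symmetric])
  finally show ?thesis unfolding pairing_upd[OF \<open>e < 8\<close>] by blast
qed

text \<open>Entries 2 and 5 multiply powers of the non-real number, and their conjugate terms are
  supplied by the real part.\<close>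

definition well_formed :: "(nat \<Rightarrow> complex) \<Rightarrow> bool"
  where "well_formed c \<longleftrightarrow> (\<forall>i. i \<noteq> 2 \<longrightarrow> i \<noteq> 5 \<longrightarrow> c i \<in> \<real>)"

text \<open>Only the first two unknowns are eliminated this way; their coefficients are real, so
  scaling by them keeps real entries real.\<close>

lemma well_formed_eliminate:
  assumes "e < 2" and "\<And>c. c \<in> J \<Longrightarrow> well_formed c" and "c \<in> eliminate e J"
  shows "well_formed c"
proof (cases "c \<in> J")
  case False
  then obtain a b where "a \<in> J" "b \<in> J" "c = combine e a b"
    using assms(3) unfolding eliminate_def by auto
  then show ?thesis using assms(1,2) unfolding well_formed_def combine_def
    by (auto intro!: Reals_diff Reals_mult)
qed (rule assms(2))

lemma level_eliminate:
  assumes "\<And>c i. c \<in> J \<Longrightarrow> level m S (c i)" and "c \<in> eliminate e J"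
  shows "level (m + 2) S (c i)"
proof (cases "c \<in> J")
  case True
  then show ?thesis using assms(1) level_mono by (metis le_add1)
next
  case False
  then obtain a b where ab: "a \<in> J" "b \<in> J" "c = combine e a b"
    using assms(2) unfolding eliminate_def by auto
  then have "level (Suc (Suc m)) S (a e * b i - b e * a i)"
    using assms(1) by (intro level_diff level_mult)
  then show ?thesis by (simp add: ab combine_def)
qed

section \<open>Quadratic forms that decide the last elimination\<close>

text \<open>The comparison \<open>Equal\<close> is a placeholder here and in
  \<open>det_atom\<close>; the sign is imposed later by \<open>with_sign\<close>.\<close>

definition linear_atom :: "complex \<Rightarrow> complex \<Rightarrow> complex \<Rightarrow> complex atom"
  where "linear_atom E F G = Atom 0 0 0 0 E F G Equal"

definition slope_atom :: "(nat \<Rightarrow> complex) \<Rightarrow> complex atom"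
  where "slope_atom c = linear_atom (c 2) (c 3) (c 4)"

definition offset_atom :: "(nat \<Rightarrow> complex) \<Rightarrow> complex atom"
  where "offset_atom c = linear_atom (c 5) (c 6) (c 7)"

text \<open>This is the expanded determinant of the slopes and offsets of \<open>c\<close> and
  \<open>d\<close>, that is, the cross-multiplied condition of Fourier-Motzkin. The fourth
  coefficient collects the mixed products of a power with its conjugate.\<close>

definition det_atom :: "(nat \<Rightarrow> complex) \<Rightarrow> (nat \<Rightarrow> complex) \<Rightarrow> complex atom"
  where "det_atom c d = Atom
    (c 2 * d 5 - d 2 * c 5)
    (c 2 * d 6 + c 3 * d 5 - (d 2 * c 6 + d 3 * c 5))
    (c 3 * d 6 - d 3 * c 6)
    (c 2 * cnj (d 5) + cnj (c 2) * d 5 - (d 2 * cnj (c 5) + cnj (d 2) * c 5))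
    (c 2 * d 7 + c 4 * d 5 - (d 2 * c 7 + d 4 * c 5))
    (c 3 * d 7 + c 4 * d 6 - (d 3 * c 7 + d 4 * c 6))
    (c 4 * d 7 - d 4 * c 7)
    Equal"

lemma Re_linear_atom:
  "Re (atom_value \<alpha> \<rho> n (linear_atom E F G)) = 2 * Re (E * \<alpha> ^ n) + Re (F * \<rho> ^ n) + Re G"
  by (simp add: linear_atom_def flip: complex_cnj_power)

lemma atom_value_det_atom:
  assumes "well_formed c" and "well_formed d"
  shows "atom_value \<alpha> \<rho> n (det_atom c d) =
    atom_value \<alpha> \<rho> n (slope_atom c) * atom_value \<alpha> \<rho> n (offset_atom d)
    - atom_value \<alpha> \<rho> n (slope_atom d) * atom_value \<alpha> \<rho> n (offset_atom c)"
proof -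
  have r: "cnj (c i) = c i" "cnj (d i) = d i" if "i \<in> {3, 4, 6, 7}" for i
    using assms that unfolding well_formed_def by (auto simp: Reals_cnj_iff)
  define a where "a = \<alpha> ^ n"
  define z where "z = \<rho> ^ n"
  have pw: "\<alpha> ^ (2 * n) = a\<^sup>2" "cnj \<alpha> ^ (2 * n) = (cnj a)\<^sup>2" "\<rho> ^ (2 * n) = z\<^sup>2" "cnj \<alpha> ^ n = cnj a"
    by (simp_all add: a_def z_def power_mult[symmetric] mult.commute)
  have "complex_of_real (cmod \<alpha> ^ (2 * n)) = of_real ((cmod a)\<^sup>2)"
    by (simp add: a_def norm_power power_mult[symmetric] mult.commute)
  then have md: "complex_of_real (cmod \<alpha> ^ (2 * n)) = a * cnj a"
    by (simp only: complex_norm_square)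
  show ?thesis
    unfolding det_atom_def slope_atom_def offset_atom_def linear_atom_def atom_value.simps md pw
      a_def[symmetric] z_def[symmetric]
    by (simp add: r power2_eq_square) algebra
qed

lemma Re_det_atom:
  assumes "well_formed c" and "well_formed d" and "\<rho> \<in> \<real>"
  shows "Re (atom_value \<alpha> \<rho> n (det_atom c d)) =
    Re (atom_value \<alpha> \<rho> n (slope_atom c)) * Re (atom_value \<alpha> \<rho> n (offset_atom d))
    - Re (atom_value \<alpha> \<rho> n (slope_atom d)) * Re (atom_value \<alpha> \<rho> n (offset_atom c))"
proof -
  have "Im (atom_value \<alpha> \<rho> n (linear_atom E F G)) = 0" if "F \<in> \<real>" "G \<in> \<real>" for E F G
    using that assms(3) Reals_power[OF assms(3), of n]
    by (simp add: linear_atom_def complex_is_Real_iff flip: complex_cnj_power)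
  then have "Im (atom_value \<alpha> \<rho> n (slope_atom b)) = 0" "Im (atom_value \<alpha> \<rho> n (offset_atom b)) = 0"
    if "well_formed b" for b
    using that by (simp_all add: slope_atom_def offset_atom_def well_formed_def)
  then show ?thesis unfolding atom_value_det_atom[OF assms(1,2)] using assms by simp
qed

definition sign_atoms :: "(nat \<Rightarrow> complex) set \<Rightarrow> complex atom set"
  where "sign_atoms J = slope_atom ` J \<union> offset_atom ` J \<union> (\<lambda>(c, d). det_atom c d) ` (J \<times> J)"

lemma sign_atoms_finite: "finite J \<Longrightarrow> finite (sign_atoms J)"
  by (simp add: sign_atoms_def)

lemma card_sign_atoms_le:
  assumes "finite J" and "card J \<le> k"
  shows "card (sign_atoms J) \<le> 2 * k + k\<^sup>2"
proof -
  have "card ((\<lambda>(c, d). det_atom c d) ` (J \<times> J)) \<le> card (J \<times> J)"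
    using assms by (intro card_image_le) auto
  also have "\<dots> \<le> k\<^sup>2" using assms(2) by (simp add: card_cartesian_product power2_eq_square mult_mono)
  finally have "card ((\<lambda>(c, d). det_atom c d) ` (J \<times> J)) \<le> k\<^sup>2" .
  moreover have "card (slope_atom ` J) \<le> k" "card (offset_atom ` J) \<le> k"
    using card_image_le[OF assms(1)] assms(2) order_trans by blast+
  ultimately show ?thesis unfolding sign_atoms_def
    using card_Un_le[of "slope_atom ` J \<union> offset_atom ` J" "(\<lambda>(c, d). det_atom c d) ` (J \<times> J)"]
      card_Un_le[of "slope_atom ` J" "offset_atom ` J"] by linarith
qed

text \<open>The coefficients of \<open>det_atom\<close> are differences of sums of products, hence
  three operations deep.\<close>

lemma level_sign_atoms:
  assumes lev: "\<And>c i. c \<in> J \<Longrightarrow> level m S (c i)" and "1 \<le> S"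
    and "\<phi> \<in> sign_atoms J" and x: "x \<in> set_atom \<phi>"
  shows "level (m + 3) S x"
proof -
  consider c where "c \<in> J" "\<phi> = slope_atom c \<or> \<phi> = offset_atom c"
    | c d where "c \<in> J" "d \<in> J" "\<phi> = det_atom c d"
    using assms(3) unfolding sign_atoms_def by auto
  then show ?thesis
  proof cases
    case 1
    then have "level m S x" using x lev level_0_1[OF \<open>1 \<le> S\<close>]
      by (auto simp: slope_atom_def offset_atom_def linear_atom_def)
    then show ?thesis by (rule level_mono) simp
  next
    case 2
    have "level (Suc (Suc (Suc m))) S x"
      using x lev[OF 2(1)] lev[OF 2(2)] unfolding 2 det_atom_def
      by (auto intro!: level_diff level_add level_mult level_cnj intro: level_Suc)
    then show ?thesis by (simp add: numeral_3_eq_3)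
  qed
qed

text \<open>Algebraicity follows from the level of the coefficients, so only the reality part of
  \<open>admissible\<close> is tracked separately.\<close>

definition real_coeffs :: "complex atom \<Rightarrow> bool"
  where "real_coeffs \<phi> \<longleftrightarrow> {coeff_C \<phi>, coeff_D \<phi>, coeff_F \<phi>, coeff_G \<phi>} \<subseteq> \<real>"

lemma real_coeffs_sign_atoms:
  assumes "\<And>c. c \<in> J \<Longrightarrow> well_formed c" and "\<phi> \<in> sign_atoms J"
  shows "real_coeffs \<phi>"
proof -
  have "x * cnj y + cnj x * y \<in> \<real>" for x y :: complex
    by (simp add: complex_is_Real_iff)
  then show ?thesis using assms
    unfolding sign_atoms_def well_formed_def real_coeffs_def
    by (auto simp: slope_atom_def offset_atom_def linear_atom_def det_atom_def
        intro!: Reals_diff Reals_add Reals_mult)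
qed

lemma admissibleI:
  assumes "real_coeffs \<phi>" and "\<And>x. x \<in> set_atom \<phi> \<Longrightarrow> level m S x"
  shows "admissible \<phi>"
  using assms bounded_root_imp_algebraic unfolding level_def real_coeffs_def admissible_def
  by (cases \<phi>) auto

text \<open>With the first two entries zero, each constraint is an offset plus \<open>l\<close>
  times a slope, both depending on the exponent. Fourier-Motzkin then expresses solvability through
  the signs of slopes, offsets and determinants alone.\<close>

lemma ex_parameter_cong:
  assumes "finite J" and wf: "\<And>c. c \<in> J \<Longrightarrow> well_formed c" and "\<rho> \<in> \<real>"
    and zero: "\<And>c. c \<in> J \<Longrightarrow> c 0 = 0 \<and> c 1 = 0"
    and sgn: "\<And>\<phi>. \<phi> \<in> sign_atoms J \<Longrightarrow>
      sgn (Re (atom_value \<alpha> \<rho> n \<phi>)) = sgn (Re (atom_value \<alpha> \<rho> n' \<phi>))"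
  shows "(\<exists>l. \<forall>c\<in>J. 0 \<le> pairing c (unknowns \<nu> \<mu> l (\<alpha> ^ n) (\<rho> ^ n))) \<longleftrightarrow>
    (\<exists>l. \<forall>c\<in>J. 0 \<le> pairing c (unknowns \<nu> \<mu> l (\<alpha> ^ n') (\<rho> ^ n')))"
proof -
  define v where "v n \<phi> = Re (atom_value \<alpha> \<rho> n \<phi>)" for n \<phi>
  have eq: "(\<exists>l. \<forall>c\<in>J. 0 \<le> pairing c (unknowns \<nu> \<mu> l (\<alpha> ^ n) (\<rho> ^ n))) \<longleftrightarrow>
      (\<forall>c\<in>J. v n (slope_atom c) = 0 \<longrightarrow> 0 \<le> v n (offset_atom c)) \<and>
      (\<forall>c\<in>J. \<forall>d\<in>J. 0 < v n (slope_atom c) \<and> v n (slope_atom d) < 0 \<longrightarrow> 0 \<le> v n (det_atom c d))" for n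
  proof -
    have "pairing c (unknowns \<nu> \<mu> l (\<alpha> ^ n) (\<rho> ^ n)) = v n (offset_atom c) + l * v n (slope_atom c)"
      if "c \<in> J" for c l
      using zero[OF that]
      by (simp add: pairing_unknowns v_def slope_atom_def offset_atom_def Re_linear_atom)
    then have "(\<exists>l. \<forall>c\<in>J. 0 \<le> pairing c (unknowns \<nu> \<mu> l (\<alpha> ^ n) (\<rho> ^ n))) \<longleftrightarrow>
        (\<exists>l. \<forall>c\<in>J. 0 \<le> v n (offset_atom c) + l * v n (slope_atom c))" by simp
    also note fourier_motzkin[OF assms(1)]
    also have "v n (slope_atom c) * v n (offset_atom d) - v n (slope_atom d) * v n (offset_atom c) =
        v n (det_atom c d)" if "c \<in> J" "d \<in> J" for c d
      unfolding v_def using Re_det_atom wf that \<open>\<rho> \<in> \<real>\<close> by simp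
    ultimately show ?thesis by simp
  qed
  have s: "(v n \<phi> = 0 \<longleftrightarrow> v n' \<phi> = 0) \<and> (0 < v n \<phi> \<longleftrightarrow> 0 < v n' \<phi>) \<and>
      (v n \<phi> < 0 \<longleftrightarrow> v n' \<phi> < 0) \<and> (0 \<le> v n \<phi> \<longleftrightarrow> 0 \<le> v n' \<phi>)" if "\<phi> \<in> sign_atoms J" for \<phi>
    using sgn[OF that] unfolding v_def by (auto simp: sgn_if split: if_splits)
  have "slope_atom c \<in> sign_atoms J" "offset_atom c \<in> sign_atoms J" if "c \<in> J" for c
    using that by (auto simp: sign_atoms_def)
  moreover have "det_atom c d \<in> sign_atoms J" if "c \<in> J" "d \<in> J" for c d
    using that by (auto simp: sign_atoms_def)
  ultimately show ?thesis unfolding eq using s by (simp cong: ball_cong)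
qed

section \<open>From sign patterns to systems of constraints\<close>

definition equation_constraints ::
  "complex \<Rightarrow> complex \<Rightarrow> complex \<Rightarrow> complex \<Rightarrow> complex \<Rightarrow> complex \<Rightarrow> complex \<Rightarrow> (nat \<Rightarrow> complex) list"
  where "equation_constraints f g h k s t r =
    [vec [- r, - t, h, k, 0, f, g, - s], vec [r, t, - h, - k, 0, - f, - g, s]]"

text \<open>\<open>\<mu> \<le> 1\<close> and \<open>\<nu> \<le> 1\<close> are implied by the other constraints.\<close>

definition range_constraints :: "(nat \<Rightarrow> complex) list"
  where "range_constraints =
    [vec [1], vec [0, 1], vec [- 1, - 1, 0, 0, 0, 0, 0, 1],
     vec [0, 0, 0, 0, 1], vec [0, 0, 0, 0, - 1, 0, 0, 1]]"

text \<open>Under the reality assumptions both sides of the equation are real, so it amounts to two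
  opposite real inequalities.\<close>

lemma equation_constraints_iff:
  assumes "g \<in> \<real>" "k \<in> \<real>" "s \<in> \<real>" "t \<in> \<real>" "r \<in> \<real>" "z \<in> \<real>"
  shows "f * a + cnj f * cnj a + g * z + of_real l * (h * a + cnj h * cnj a + k * z) =
      s + of_real \<mu> * t + of_real \<nu> * r \<longleftrightarrow>
    (\<forall>c\<in>set (equation_constraints f g h k s t r). 0 \<le> pairing c (unknowns \<nu> \<mu> l a z))"
  using assms
  by (auto simp: equation_constraints_def pairing_unknowns vec_def complex_eq_iff
      complex_is_Real_iff algebra_simps)

lemma range_constraints_iff:
  "(\<forall>c\<in>set range_constraints. 0 \<le> pairing c (unknowns \<nu> \<mu> l a z)) \<longleftrightarrow>
    0 \<le> l \<and> l \<le> 1 \<and> 0 \<le> \<mu> \<and> \<mu> \<le> 1 \<and> 0 \<le> \<nu> \<and> \<nu> \<le> 1 \<and> \<mu> + \<nu> \<le> 1"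
  by (auto simp: range_constraints_def pairing_unknowns vec_def)

lemma level_vec:
  assumes "\<And>x. x \<in> set xs \<Longrightarrow> level m S x" and "1 \<le> S"
  shows "level m S (vec xs i)"
  using assms level_0_1 by (simp add: vec_def)

lemma well_formed_equation_constraints:
  assumes "g \<in> \<real>" "k \<in> \<real>" "s \<in> \<real>" "t \<in> \<real>" "r \<in> \<real>"
    and "c \<in> set (equation_constraints f g h k s t r)"
  shows "well_formed c"
  using assms unfolding well_formed_def
  by (auto simp: equation_constraints_def vec_def less_Suc_eq)

lemma well_formed_range_constraints: "c \<in> set range_constraints \<Longrightarrow> well_formed c"
  unfolding well_formed_def range_constraints_def by (auto simp: vec_def less_Suc_eq)

lemma level_equation_constraints:
  assumes "level 0 S f" "level 0 S g" "level 0 S h" "level 0 S k" "level 0 S s" "level 0 S t"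
    "level 0 S r" and S: "1 \<le> S"
    and "c \<in> set (equation_constraints f g h k s t r)"
  shows "level 1 S (c i)"
proof -
  have *: "level 1 S x" "level 1 S (- x)" if "level 0 S x" for x
    using level_Suc[OF that] level_minus[OF that S] by simp_all
  show ?thesis
    using assms(9) assms(1-7)[THEN *(1)] assms(1-7)[THEN *(2)] level_0_1[OF S, of 1]
    unfolding equation_constraints_def by (auto intro!: level_vec[OF _ S])
qed

lemma level_range_constraints:
  assumes "1 \<le> S" and "c \<in> set range_constraints"
  shows "level 1 S (c i)"
proof -
  have "level 1 S (- 1)" using level_minus[OF level_0_1(2)[OF assms(1), of 0] assms(1)] by simp
  then show ?thesis
    using assms(2) level_0_1[OF assms(1), of 1]
    unfolding range_constraints_def by (auto intro!: level_vec[OF _ assms(1)])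
qed

section \<open>Systems prescribing a sign pattern\<close>

text \<open>A negative sign is expressed by negating all coefficients, since only
  \<open>Greater\<close> and \<open>Equal\<close> are available.\<close>

fun with_sign :: "real \<Rightarrow> complex atom \<Rightarrow> complex atom"
  where "with_sign \<sigma> (Atom A B C D E F G _) =
    (if \<sigma> = 1 then Atom A B C D E F G Greater
     else if \<sigma> = 0 then Atom A B C D E F G Equal
     else Atom (- A) (- B) (- C) (- D) (- E) (- F) (- G) Greater)"

lemma atom_holds_with_sign:
  assumes "admissible \<phi>" and "\<rho> \<in> \<real>" and "\<sigma> \<in> {-1, 0, 1}"
  shows "atom_holds \<alpha> \<rho> n (with_sign \<sigma> \<phi>) \<longleftrightarrow> sgn (Re (atom_value \<alpha> \<rho> n \<phi>)) = \<sigma>"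
proof -
  obtain A B C D E F G c where \<phi>: "\<phi> = Atom A B C D E F G c" by (cases \<phi>)
  have *: "atom_value \<alpha> \<rho> n (Atom A B C D E F G c') = atom_value \<alpha> \<rho> n \<phi>" for c'
    by (simp add: \<phi>)
  have neg: "atom_value \<alpha> \<rho> n (Atom (- A) (- B) (- C) (- D) (- E) (- F) (- G) c') =
      - atom_value \<alpha> \<rho> n \<phi>" for c'
    by (simp add: \<phi>)
  have "Im (atom_value \<alpha> \<rho> n \<phi>) = 0"
    using atom_value_real[OF assms(1,2)] by (simp add: complex_is_Real_iff)
  then have "atom_value \<alpha> \<rho> n \<phi> = 0 \<longleftrightarrow> Re (atom_value \<alpha> \<rho> n \<phi>) = 0"
    by (simp add: complex_eq_iff)
  then show ?thesis using assms(3)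
    by (auto simp: atom_holds_def \<phi>[THEN arg_cong[of _ _ "with_sign \<sigma>"]] * neg sgn_if
        simp del: atom_value.simps split: if_splits)
qed

lemma real_coeffs_with_sign: "real_coeffs \<phi> \<Longrightarrow> real_coeffs (with_sign \<sigma> \<phi>)"
  by (cases \<phi>; cases "\<sigma> = 1"; cases "\<sigma> = 0") (simp_all add: real_coeffs_def)

lemma level_with_sign:
  assumes "\<And>x. x \<in> set_atom \<phi> \<Longrightarrow> level m S x" and "1 \<le> S" and "x \<in> set_atom (with_sign \<sigma> \<phi>)"
  shows "level (Suc m) S x"
proof -
  have "level (Suc m) S y \<and> level (Suc m) S (- y)" if "y \<in> set_atom \<phi>" for y
    using level_Suc level_minus assms(1)[OF that] assms(2) by blast
  then show ?thesis using assms(3)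
    by (cases \<phi>; cases "\<sigma> = 1"; cases "\<sigma> = 0") auto
qed

text \<open>Pads the list of systems, so that the number of disjuncts is the same for all
  inputs.\<close>

definition false_atom :: "complex atom"
  where "false_atom = Atom 0 0 0 0 0 0 1 Equal"

lemma not_atom_holds_false_atom: "\<not> atom_holds \<alpha> \<rho> n false_atom"
  by (simp add: atom_holds_def false_atom_def)

text \<open>There are at most \<open>3 ^ N\<close> sign patterns on \<open>T\<close>. Each pattern
  attained at some \<open>n\<close> with \<open>Q n\<close> becomes a system; the assumption on
  \<open>Q\<close> ensures that any other exponent with this pattern satisfies \<open>Q\<close>
  too.\<close>

lemma ex_sign_systems:
  assumes "finite T" and "card T \<le> N" and adm: "\<And>\<phi>. \<phi> \<in> T \<Longrightarrow> admissible \<phi>" and "\<rho> \<in> \<real>"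
    and sgn: "\<And>n n'. (\<And>\<phi>. \<phi> \<in> T \<Longrightarrow>
        sgn (Re (atom_value \<alpha> \<rho> n \<phi>)) = sgn (Re (atom_value \<alpha> \<rho> n' \<phi>))) \<Longrightarrow> Q n \<longleftrightarrow> Q n'"
  obtains Sys :: "nat \<Rightarrow> complex atom list" where
    "\<And>i. length (Sys i) \<le> N + 1"
    "\<And>i \<phi>. \<phi> \<in> set (Sys i) \<Longrightarrow> \<phi> = false_atom \<or> (\<exists>\<sigma>. \<exists>\<psi>\<in>T. \<phi> = with_sign \<sigma> \<psi>)"
    "\<And>n. Q n \<longleftrightarrow> (\<exists>i\<in>{1..3 ^ N}. \<forall>\<phi>\<in>set (Sys i). atom_holds \<alpha> \<rho> n \<phi>)"
proof -
  obtain ts where ts: "set ts = T" "distinct ts" using finite_distinct_list[OF assms(1)] by blast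
  define pattern where "pattern n = (\<lambda>\<phi>\<in>T. sgn (Re (atom_value \<alpha> \<rho> n \<phi>)))" for n
  define U where "U = PiE T (\<lambda>_. {-1, 0, 1::real})"
  define V where "V = pattern ` {n. Q n}"
  have pattern_U: "pattern n \<in> U" for n by (auto simp: pattern_def U_def sgn_if)
  have "finite U" unfolding U_def using assms(1) by (intro finite_PiE) auto
  have "V \<subseteq> U" using pattern_U by (auto simp: V_def)
  have "card V \<le> card U" using \<open>finite U\<close> \<open>V \<subseteq> U\<close> by (rule card_mono)
  also have "card U = 3 ^ card T" unfolding U_def using assms(1) by (simp add: card_PiE numeral_3_eq_3)
  also have "\<dots> \<le> 3 ^ N" using assms(2) by (intro power_increasing) auto
  finally have "card V \<le> 3 ^ N" .
  obtain vs where vs: "set vs = V" "distinct vs"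
    using finite_distinct_list finite_subset[OF \<open>V \<subseteq> U\<close> \<open>finite U\<close>] by blast
  have len: "length vs \<le> 3 ^ N" using distinct_card[OF vs(2)] vs(1) \<open>card V \<le> 3 ^ N\<close> by simp
  \<comment> \<open>Systems are numbered from 1 and list entries from 0. Padding systems have length
    1, which the bound \<open>N + 1\<close> admits even for \<open>N = 0\<close>.\<close>
  define Sys where "Sys i = (if 1 \<le> i \<and> i \<le> length vs then map (\<lambda>\<phi>. with_sign ((vs ! (i - 1)) \<phi>) \<phi>) ts
    else [false_atom])" for i
  have holds: "(\<forall>\<phi>\<in>set (Sys i). atom_holds \<alpha> \<rho> n \<phi>) \<longleftrightarrow> vs ! (i - 1) = pattern n"
    if i: "1 \<le> i" "i \<le> length vs" for i n
  proof -
    define \<sigma> where "\<sigma> = vs ! (i - 1)"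
    have "\<sigma> \<in> set vs" unfolding \<sigma>_def using i by (intro nth_mem) auto
    then have "\<sigma> \<in> U" using vs(1) \<open>V \<subseteq> U\<close> by blast
    have "(\<forall>\<phi>\<in>set (Sys i). atom_holds \<alpha> \<rho> n \<phi>) \<longleftrightarrow> (\<forall>\<phi>\<in>T. atom_holds \<alpha> \<rho> n (with_sign (\<sigma> \<phi>) \<phi>))"
      using i ts by (simp add: Sys_def \<sigma>_def)
    also have "\<dots> \<longleftrightarrow> (\<forall>\<phi>\<in>T. sgn (Re (atom_value \<alpha> \<rho> n \<phi>)) = \<sigma> \<phi>)"
    proof (rule ball_cong[OF refl])
      fix \<phi> assume "\<phi> \<in> T"
      then have "\<sigma> \<phi> \<in> {-1, 0, 1}" using \<open>\<sigma> \<in> U\<close> by (auto simp: U_def)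
      then show "atom_holds \<alpha> \<rho> n (with_sign (\<sigma> \<phi>) \<phi>) \<longleftrightarrow> sgn (Re (atom_value \<alpha> \<rho> n \<phi>)) = \<sigma> \<phi>"
        using adm[OF \<open>\<phi> \<in> T\<close>] \<open>\<rho> \<in> \<real>\<close> by (intro atom_holds_with_sign)
    qed
    also have "\<dots> \<longleftrightarrow> (\<forall>\<phi>\<in>T. \<sigma> \<phi> = pattern n \<phi>)" by (auto simp: pattern_def)
    also have "\<dots> \<longleftrightarrow> \<sigma> = pattern n"
      using PiE_ext[of \<sigma> T "\<lambda>_. {-1, 0, 1::real}" "pattern n"] \<open>\<sigma> \<in> U\<close> pattern_U[of n]
      unfolding U_def by auto
    finally show ?thesis unfolding \<sigma>_def .
  qed
  show ?thesis
  proof (rule that)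
    have "length ts \<le> N" using distinct_card[OF ts(2)] ts(1) assms(2) by simp
    then show "length (Sys i) \<le> N + 1" for i by (simp add: Sys_def)
    show "\<phi> = false_atom \<or> (\<exists>\<sigma>. \<exists>\<psi>\<in>T. \<phi> = with_sign \<sigma> \<psi>)" if "\<phi> \<in> set (Sys i)" for i \<phi>
      using that ts by (auto simp: Sys_def split: if_splits)
    show "Q n \<longleftrightarrow> (\<exists>i\<in>{1..3 ^ N}. \<forall>\<phi>\<in>set (Sys i). atom_holds \<alpha> \<rho> n \<phi>)" for n
    proof
      assume "Q n"
      then have "pattern n \<in> set vs" using vs by (auto simp: V_def)
      then obtain j where j: "j < length vs" "vs ! j = pattern n" by (auto simp: in_set_conv_nth)
      then have "\<forall>\<phi>\<in>set (Sys (Suc j)). atom_holds \<alpha> \<rho> n \<phi>" by (subst holds) auto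
      moreover have "Suc j \<in> {1..3 ^ N}" using j len by auto
      ultimately show "\<exists>i\<in>{1..3 ^ N}. \<forall>\<phi>\<in>set (Sys i). atom_holds \<alpha> \<rho> n \<phi>" by blast
    next
      assume "\<exists>i\<in>{1..3 ^ N}. \<forall>\<phi>\<in>set (Sys i). atom_holds \<alpha> \<rho> n \<phi>"
      then obtain i where i: "1 \<le> i" "\<forall>\<phi>\<in>set (Sys i). atom_holds \<alpha> \<rho> n \<phi>" by auto
      have "i \<le> length vs"
      proof (rule ccontr)
        assume "\<not> i \<le> length vs"
        then have "Sys i = [false_atom]" by (simp add: Sys_def)
        then show False using i(2) not_atom_holds_false_atom by simp
      qed
      then have eq: "vs ! (i - 1) = pattern n" and "vs ! (i - 1) \<in> set vs"
        using holds[OF i(1)] i by (blast, intro nth_mem, auto)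
      then obtain n' where n': "Q n'" "pattern n = pattern n'" using vs by (auto simp: V_def)
      have "Q n \<longleftrightarrow> Q n'"
      proof (rule sgn)
        fix \<phi> assume "\<phi> \<in> T"
        then show "sgn (Re (atom_value \<alpha> \<rho> n \<phi>)) = sgn (Re (atom_value \<alpha> \<rho> n' \<phi>))"
          using fun_cong[OF n'(2), of \<phi>] by (simp add: pattern_def)
      qed
      then show "Q n" using n' by simp
    qed
  qed
qed

section \<open>Polynomial size of the descriptions\<close>

text \<open>Since \<open>op_bound\<close> is a polynomial, so is its composition with itself any
  fixed number of times.\<close>

lemma ex_poly_op_bound: "\<exists>P :: nat poly. \<forall>S. (op_bound ^^ m) S = poly P S"
proof (induction m)
  case 0
  show ?case by (intro exI[of _ "[:0, 1:]"]) simp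
next
  case (Suc m)
  then obtain P :: "nat poly" where P: "\<And>S. (op_bound ^^ m) S = poly P S" by blast
  show ?case
    by (intro exI[of _ "P\<^sup>2 * (P\<^sup>2 + 1) * (2 * P + 3) + P"] allI)
      (simp add: P op_bound_def[of "poly P _"])
qed

lemma ex_poly_rep_bound: "\<exists>P :: nat poly. \<forall>S. rep_bound ((op_bound ^^ m) S) = poly P S"
proof -
  obtain P :: "nat poly" where P: "\<And>S. (op_bound ^^ m) S = poly P S"
    using ex_poly_op_bound by blast
  obtain Q :: "nat poly" where Q: "\<And>S. (op_bound ^^ Suc m) S = poly Q S"
    using ex_poly_op_bound by blast
  show ?thesis
    using P Q
    by (intro exI[of _ "(P + 1) * (P + P * (P + 2) + 2) + 5 * Q + 2 * P + 32"] allI)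
      (simp add: rep_bound_def)
qed

text \<open>Each atom has seven coefficients with a small representation each, and one bit for its
  comparison.\<close>

lemma ex_small_description:
  assumes "\<And>\<phi> x. \<phi> \<in> set \<Phi> \<Longrightarrow> x \<in> set_atom \<phi> \<Longrightarrow> level m S x"
  shows "\<exists>\<Delta>. describes \<Delta> \<Phi> \<and>
    description_size \<Delta> \<le> length \<Phi> * (7 * rep_bound ((op_bound ^^ m) S) + 1)"
proof -
  define K where "K = rep_bound ((op_bound ^^ m) S)"
  define \<R> where "\<R> x = (SOME R. represents R x \<and> rep_size R \<le> K)" for x
  have \<R>: "represents (\<R> x) x \<and> rep_size (\<R> x) \<le> K" if "level m S x" for x
    unfolding \<R>_def K_def using someI_ex[OF ex_small_representation[OF that[unfolded level_def]]] .
  define \<Delta> where "\<Delta> = map (map_atom \<R>) \<Phi>"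
  have "rel_atom represents (map_atom \<R> \<phi>) \<phi>" if "\<phi> \<in> set \<Phi>" for \<phi>
    using \<R> assms[OF that] by (cases \<phi>) simp
  then have "describes \<Delta> \<Phi>"
    by (simp add: describes_def \<Delta>_def list_all2_map1 list_all2_same)
  moreover have "atom_size (map_atom \<R> \<phi>) \<le> 7 * K + 1" if "\<phi> \<in> set \<Phi>" for \<phi>
  proof -
    have "rep_size (\<R> x) \<le> K" if "x \<in> set_atom \<phi>" for x
      using \<R> assms[OF \<open>\<phi> \<in> set \<Phi>\<close> that] by blast
    then have "rep_size (\<R> (coeff_A \<phi>)) \<le> K" "rep_size (\<R> (coeff_B \<phi>)) \<le> K"
      "rep_size (\<R> (coeff_C \<phi>)) \<le> K" "rep_size (\<R> (coeff_D \<phi>)) \<le> K"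
      "rep_size (\<R> (coeff_E \<phi>)) \<le> K" "rep_size (\<R> (coeff_F \<phi>)) \<le> K"
      "rep_size (\<R> (coeff_G \<phi>)) \<le> K"
      by (cases \<phi>; simp)+
    then show ?thesis by (simp add: atom_size_def atom.map_sel)
  qed
  then have "description_size \<Delta> \<le> length \<Phi> * (7 * K + 1)"
    unfolding description_size_def \<Delta>_def map_map o_def by (intro sum_list_map_le)
  ultimately show ?thesis unfolding K_def by blast
qed

section \<open>The constraints of the original sentence\<close>

definition initial_constraints ::
  "(nat \<Rightarrow> complex) \<Rightarrow> (nat \<Rightarrow> complex) \<Rightarrow> (nat \<Rightarrow> complex) \<Rightarrow> (nat \<Rightarrow> complex) \<Rightarrow>
   (nat \<Rightarrow> complex) \<Rightarrow> (nat \<Rightarrow> complex) \<Rightarrow> (nat \<Rightarrow> complex) \<Rightarrow> (nat \<Rightarrow> complex) set"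
  where "initial_constraints f g h k s t r = set (range_constraints @
    concat (map (\<lambda>i. equation_constraints (f i) (g i) (h i) (k i) (s i) (t i) (r i)) [1, 2, 3]))"

text \<open>Five range constraints and two inequalities for each of three equations.\<close>

lemma card_initial_constraints_le: "card (initial_constraints f g h k s t r) \<le> 11"
  unfolding initial_constraints_def
  by (rule order_trans[OF card_length]) (simp add: range_constraints_def equation_constraints_def)

lemma finite_initial_constraints: "finite (initial_constraints f g h k s t r)"
  by (simp add: initial_constraints_def)

lemma initial_constraints_eq:
  "initial_constraints f g h k s t r = set range_constraints \<union>
    (\<Union>i\<in>{1..3}. set (equation_constraints (f i) (g i) (h i) (k i) (s i) (t i) (r i)))"
proof -
  have "set [1, 2, 3] = {1..3::nat}" by auto
  then show ?thesis unfolding initial_constraints_def set_append set_concat set_map by blast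
qed

lemma initial_constraintsE:
  assumes "c \<in> initial_constraints f g h k s t r"
  obtains "c \<in> set range_constraints"
  | i where "i \<in> {1..3}" "c \<in> set (equation_constraints (f i) (g i) (h i) (k i) (s i) (t i) (r i))"
  using assms unfolding initial_constraints_eq by blast

lemma well_formed_initial_constraints:
  assumes "\<forall>i\<in>{1..3}. g i \<in> \<real> \<and> k i \<in> \<real> \<and> s i \<in> \<real> \<and> t i \<in> \<real> \<and> r i \<in> \<real>"
    and "c \<in> initial_constraints f g h k s t r"
  shows "well_formed c"
  using assms(2)
proof (cases rule: initial_constraintsE)
  case (2 i)
  with assms(1) have "g i \<in> \<real>" "k i \<in> \<real>" "s i \<in> \<real>" "t i \<in> \<real>" "r i \<in> \<real>" by blast+
  then show ?thesis using 2(2) by (rule well_formed_equation_constraints)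
qed (rule well_formed_range_constraints)

lemma level_initial_constraints:
  assumes "\<forall>i\<in>{1..3}. level 0 S (f i) \<and> level 0 S (g i) \<and> level 0 S (h i) \<and> level 0 S (k i) \<and>
      level 0 S (s i) \<and> level 0 S (t i) \<and> level 0 S (r i)"
    and "1 \<le> S" and "c \<in> initial_constraints f g h k s t r"
  shows "level 1 S (c i)"
  using assms(3)
proof (cases rule: initial_constraintsE)
  case (2 j)
  with assms(1) have "level 0 S (f j)" "level 0 S (g j)" "level 0 S (h j)" "level 0 S (k j)"
    "level 0 S (s j)" "level 0 S (t j)" "level 0 S (r j)" by blast+
  then show ?thesis using assms(2) 2(2) by (rule level_equation_constraints)
qed (rule level_range_constraints[OF assms(2)])

lemma initial_constraints_iff:
  assumes "\<forall>i\<in>{1..3}. g i \<in> \<real> \<and> k i \<in> \<real> \<and> s i \<in> \<real> \<and> t i \<in> \<real> \<and> r i \<in> \<real>" and "z \<in> \<real>"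
  shows "(\<forall>c\<in>initial_constraints f g h k s t r. 0 \<le> pairing c (unknowns \<nu> \<mu> l a z)) \<longleftrightarrow>
    0 \<le> l \<and> l \<le> 1 \<and> 0 \<le> \<mu> \<and> \<mu> \<le> 1 \<and> 0 \<le> \<nu> \<and> \<nu> \<le> 1 \<and> \<mu> + \<nu> \<le> 1 \<and>
    (\<forall>i\<in>{1..3}. f i * a + cnj (f i) * cnj a + g i * z
      + of_real l * (h i * a + cnj (h i) * cnj a + k i * z) =
      s i + of_real \<mu> * t i + of_real \<nu> * r i)"
proof -
  have "(\<forall>c\<in>initial_constraints f g h k s t r. 0 \<le> pairing c (unknowns \<nu> \<mu> l a z)) \<longleftrightarrow>
      (\<forall>c\<in>set range_constraints. 0 \<le> pairing c (unknowns \<nu> \<mu> l a z)) \<and>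
      (\<forall>i\<in>{1..3}. \<forall>c\<in>set (equation_constraints (f i) (g i) (h i) (k i) (s i) (t i) (r i)).
        0 \<le> pairing c (unknowns \<nu> \<mu> l a z))"
    unfolding initial_constraints_eq by blast
  also have "(\<forall>i\<in>{1..3}. \<forall>c\<in>set (equation_constraints (f i) (g i) (h i) (k i) (s i) (t i) (r i)).
        0 \<le> pairing c (unknowns \<nu> \<mu> l a z)) \<longleftrightarrow>
      (\<forall>i\<in>{1..3}. f i * a + cnj (f i) * cnj a + g i * z
        + of_real l * (h i * a + cnj (h i) * cnj a + k i * z) =
        s i + of_real \<mu> * t i + of_real \<nu> * r i)"
    using assms by (intro ball_cong refl equation_constraints_iff[symmetric]) auto
  finally show ?thesis unfolding range_constraints_iff by blast
qed

section \<open>Assembly of the absolute constants, the systems and the size bound\<close>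

theorem theorem4:
  shows "\<exists>(M::nat) (M'::nat) (P::nat poly).
    \<forall>(\<alpha>::complex) (\<rho>::complex) (f::nat \<Rightarrow> complex) (g::nat \<Rightarrow> complex) (h::nat \<Rightarrow> complex)
      (k::nat \<Rightarrow> complex) (s::nat \<Rightarrow> complex) (t::nat \<Rightarrow> complex) (r::nat \<Rightarrow> complex).
      \<alpha> \<in> \<bbbA> - \<real> \<and> \<rho> \<in> \<bbbA> \<inter> \<real> \<and>
      (\<forall>i\<in>{1..3}. f i \<in> \<bbbA> \<and> h i \<in> \<bbbA> \<and> g i \<in> \<bbbA> \<inter> \<real> \<and> k i \<in> \<bbbA> \<inter> \<real> \<and>
        s i \<in> \<bbbA> \<inter> \<real> \<and> t i \<in> \<bbbA> \<inter> \<real> \<and> r i \<in> \<bbbA> \<inter> \<real>) \<longrightarrow>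
      (\<exists>Sys::nat \<Rightarrow> complex atom list.
        (\<forall>i\<in>{1..M}. length (Sys i) \<le> M' \<and> (\<forall>\<phi>\<in>set (Sys i). admissible \<phi>)) \<and>
        (\<forall>n::nat.
          (\<exists>lam mu nu::real.
            0 \<le> lam \<and> lam \<le> 1 \<and> 0 \<le> mu \<and> mu \<le> 1 \<and> 0 \<le> nu \<and> nu \<le> 1 \<and> mu + nu \<le> 1 \<and>
            (\<forall>i\<in>{1..3}.
              f i * \<alpha> ^ n + cnj (f i) * cnj \<alpha> ^ n + g i * \<rho> ^ n
              + of_real lam * (h i * \<alpha> ^ n + cnj (h i) * cnj \<alpha> ^ n + k i * \<rho> ^ n)
              = s i + of_real mu * t i + of_real nu * r i))
          \<longleftrightarrow> (\<exists>i\<in>{1..M}. \<forall>\<phi>\<in>set (Sys i). atom_holds \<alpha> \<rho> n \<phi>)) \<and>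
        (\<forall>(R\<alpha>::alg_rep) (R\<rho>::alg_rep) (Rf::nat \<Rightarrow> alg_rep) (Rg::nat \<Rightarrow> alg_rep)
          (Rh::nat \<Rightarrow> alg_rep) (Rk::nat \<Rightarrow> alg_rep) (Rs::nat \<Rightarrow> alg_rep) (Rt::nat \<Rightarrow> alg_rep)
          (Rr::nat \<Rightarrow> alg_rep).
          represents R\<alpha> \<alpha> \<and> represents R\<rho> \<rho> \<and>
          (\<forall>i\<in>{1..3}. represents (Rf i) (f i) \<and> represents (Rg i) (g i) \<and>
            represents (Rh i) (h i) \<and> represents (Rk i) (k i) \<and> represents (Rs i) (s i) \<and>
            represents (Rt i) (t i) \<and> represents (Rr i) (r i)) \<longrightarrow>
          (\<forall>i\<in>{1..M}. \<exists>\<Delta>. describes \<Delta> (Sys i) \<and>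
            description_size \<Delta> \<le> poly P
              (rep_size R\<alpha> + rep_size R\<rho>
               + (\<Sum>j=1..3. rep_size (Rf j) + rep_size (Rg j) + rep_size (Rh j) + rep_size (Rk j)
                   + rep_size (Rs j) + rep_size (Rt j) + rep_size (Rr j))))))"
proof -
  \<comment> \<open>\<open>K1\<close> and \<open>K2\<close> bound the number of constraints after
    the first and second elimination, and \<open>N\<close> the number of slope, offset and
    determinant atoms. None of them depends on the input.\<close>
  define K1 K2 N :: nat where "K1 = 11 + 11\<^sup>2" and "K2 = K1 + K1\<^sup>2" and "N = 2 * K2 + K2\<^sup>2"
  \<comment> \<open>The 9 counts nested operations: one for negated inputs, two for each of two
    eliminations, three for the sign atoms and one for a final negation.\<close>
  obtain P0 :: "nat poly" where P0: "\<And>S. rep_bound ((op_bound ^^ 9) S) = poly P0 S"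
    using ex_poly_rep_bound by blast
  define P where "P = of_nat (N + 1) * (7 * P0 + 1)"
  have P: "poly P S = (N + 1) * (7 * rep_bound ((op_bound ^^ 9) S) + 1)" for S
    by (simp add: P_def P0)
  show ?thesis
  proof (rule exI[of _ "3 ^ N"], rule exI[of _ "N + 1"], rule exI[of _ P], intro allI impI, goal_cases)
    case (1 \<alpha> \<rho> f g h k s t r)
    then have \<rho>: "\<rho> \<in> \<real>"
      and real: "\<forall>i\<in>{1..3}. g i \<in> \<real> \<and> k i \<in> \<real> \<and> s i \<in> \<real> \<and> t i \<in> \<real> \<and> r i \<in> \<real>"
      and alg: "\<And>i. i \<in> {1..3} \<Longrightarrow> algebraic (f i) \<and> algebraic (g i) \<and>
        algebraic (h i) \<and> algebraic (k i) \<and> algebraic (s i) \<and> algebraic (t i) \<and> algebraic (r i)"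
      by auto
    define J0 where "J0 = initial_constraints f g h k s t r"
    define J1 where "J1 = eliminate 0 J0"
    define J2 where "J2 = eliminate 1 J1"
    define T where "T = sign_atoms J2"
    have fin: "finite J0" "finite J1" "finite J2" "finite T"
      unfolding J0_def J1_def J2_def T_def
      by (simp_all add: finite_initial_constraints eliminate_finite sign_atoms_finite)
    have "card J0 \<le> 11" unfolding J0_def by (rule card_initial_constraints_le)
    then have "card J1 \<le> K1" unfolding J1_def K1_def using fin by (intro card_eliminate_le)
    then have "card J2 \<le> K2" unfolding J2_def K2_def using fin by (intro card_eliminate_le)
    then have cardT: "card T \<le> N" unfolding T_def N_def using fin by (intro card_sign_atoms_le)
    have wf0: "well_formed c" if "c \<in> J0" for c
      using real that unfolding J0_def by (rule well_formed_initial_constraints)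
    have wf1: "well_formed c" if "c \<in> J1" for c
      using well_formed_eliminate[of 0 J0 c] wf0 that unfolding J1_def by simp
    have wf2: "well_formed c" if "c \<in> J2" for c
      using well_formed_eliminate[of 1 J1 c] wf1 that unfolding J2_def by simp
    have zero1: "c 0 = 0" if "c \<in> J1" for c
      using that unfolding J1_def eliminate_def by (auto simp: combine_def)
    \<comment> \<open>The second elimination combines vectors whose entry 0 already vanishes, so
      that entry stays zero.\<close>
    have zero2: "c 0 = 0 \<and> c 1 = 0" if "c \<in> J2" for c
    proof -
      have "combine 1 a b 0 = 0" "combine 1 a b 1 = 0" if "a \<in> J1" "b \<in> J1" for a b
        by (simp_all add: combine_def zero1[OF that(1)] zero1[OF that(2)])
      then show ?thesis using that zero1 unfolding J2_def eliminate_def by auto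
    qed

    have lev: "level 8 S x" if S: "1 \<le> S" and inputs:
        "\<forall>i\<in>{1..3}. level 0 S (f i) \<and> level 0 S (g i) \<and> level 0 S (h i) \<and> level 0 S (k i) \<and>
          level 0 S (s i) \<and> level 0 S (t i) \<and> level 0 S (r i)"
        and \<phi>: "\<phi> \<in> T" "x \<in> set_atom \<phi>" for S \<phi> x
    proof -
      have "level 1 S (c i)" if "c \<in> J0" for c i
        using inputs S that unfolding J0_def by (rule level_initial_constraints)
      then have "level (1 + 2) S (c i)" if "c \<in> J1" for c i
        using level_eliminate that unfolding J1_def by blast
      then have "level (1 + 2 + 2) S (c i)" if "c \<in> J2" for c i
        using level_eliminate that unfolding J2_def by blast
      then have "level (1 + 2 + 2 + 3) S x" using S \<phi> unfolding T_def by (rule level_sign_atoms)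
      then show ?thesis by simp
    qed
    have input: "1 \<le> S \<and> (\<forall>i\<in>{1..3}. level 0 S (f i) \<and> level 0 S (g i) \<and> level 0 S (h i) \<and>
          level 0 S (k i) \<and> level 0 S (s i) \<and> level 0 S (t i) \<and> level 0 S (r i))"
      if S: "S = rep_size R\<alpha> + rep_size R\<rho> + (\<Sum>j=1..3. rep_size (Rf j) + rep_size (Rg j)
          + rep_size (Rh j) + rep_size (Rk j) + rep_size (Rs j) + rep_size (Rt j) + rep_size (Rr j))"
        and rep: "\<forall>i\<in>{1..3}. represents (Rf i) (f i) \<and> represents (Rg i) (g i) \<and>
            represents (Rh i) (h i) \<and> represents (Rk i) (k i) \<and> represents (Rs i) (s i) \<and>
            represents (Rt i) (t i) \<and> represents (Rr i) (r i)"
      for S R\<alpha> R\<rho> Rf Rg Rh Rk Rs Rt Rr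
    proof -
      \<comment> \<open>Positivity of the total size is needed because the constants 0 and 1 are
        bounded roots only from parameter 1 on.\<close>
      have "rep_size R\<alpha> \<ge> 1" by (simp add: rep_size_def rat_size_def int_size_def)
      then have "1 \<le> S" unfolding S by linarith
      moreover have "rep_size (Rf i) + rep_size (Rg i) + rep_size (Rh i) + rep_size (Rk i)
          + rep_size (Rs i) + rep_size (Rt i) + rep_size (Rr i) \<le> S" if "i \<in> {1..3}" for i
        unfolding S using that by (intro trans_le_add2 member_le_sum) auto
      then have "rep_size (Rf i) \<le> S \<and> rep_size (Rg i) \<le> S \<and> rep_size (Rh i) \<le> S \<and> rep_size (Rk i) \<le> S
          \<and> rep_size (Rs i) \<le> S \<and> rep_size (Rt i) \<le> S \<and> rep_size (Rr i) \<le> S" if "i \<in> {1..3}" for i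
        using that by fastforce
      ultimately show ?thesis
        using rep represents_imp_bounded_root unfolding level_def funpow_0 by blast
    qed

    \<comment> \<open>Admissibility is claimed before any representations of the input are given.
      Arbitrarily chosen ones yield some parameter \<open>S0\<close>, which is enough to make the
      coefficients algebraic.\<close>
    define \<R> where "\<R> x = (SOME R. represents R x)" for x
    have \<R>: "represents (\<R> x) x" if "algebraic x" for x
      unfolding \<R>_def using ex_represents[OF that] by (rule someI_ex)
    have "\<forall>i\<in>{1..3}. represents (\<R> (f i)) (f i) \<and> represents (\<R> (g i)) (g i) \<and>
        represents (\<R> (h i)) (h i) \<and> represents (\<R> (k i)) (k i) \<and> represents (\<R> (s i)) (s i) \<and>
        represents (\<R> (t i)) (t i) \<and> represents (\<R> (r i)) (r i)"
      using \<R> alg by blast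
    from input[OF refl this] obtain S0 where S0: "1 \<le> S0" "\<forall>i\<in>{1..3}. level 0 S0 (f i) \<and>
        level 0 S0 (g i) \<and> level 0 S0 (h i) \<and> level 0 S0 (k i) \<and> level 0 S0 (s i) \<and>
        level 0 S0 (t i) \<and> level 0 S0 (r i)" by blast
    have realT: "real_coeffs \<phi>" if "\<phi> \<in> T" for \<phi>
      using real_coeffs_sign_atoms wf2 that unfolding T_def by blast
    have adm: "admissible \<phi>" if "\<phi> \<in> T" for \<phi>
      using admissibleI[OF realT[OF that]] lev[OF S0 that] by blast

    define Q where "Q n \<longleftrightarrow> (\<exists>l mu nu::real.
      0 \<le> l \<and> l \<le> 1 \<and> 0 \<le> mu \<and> mu \<le> 1 \<and> 0 \<le> nu \<and> nu \<le> 1 \<and> mu + nu \<le> 1 \<and>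
      (\<forall>i\<in>{1..3}.
        f i * \<alpha> ^ n + cnj (f i) * cnj \<alpha> ^ n + g i * \<rho> ^ n
        + of_real l * (h i * \<alpha> ^ n + cnj (h i) * cnj \<alpha> ^ n + k i * \<rho> ^ n)
        = s i + of_real mu * t i + of_real nu * r i))" for n
    \<comment> \<open>The unknowns with entries 0 and 1 are eliminated in this order by moving their
      quantifiers inwards; the remaining quantifier is left to
      \<open>ex_parameter_cong\<close>.\<close>
    have Q_iff: "Q n \<longleftrightarrow> (\<exists>l. \<forall>c\<in>J2. 0 \<le> pairing c (unknowns 0 0 l (\<alpha> ^ n) (\<rho> ^ n)))" for n
    proof -
      have "Q n \<longleftrightarrow> (\<exists>l mu nu. \<forall>c\<in>J0. 0 \<le> pairing c (unknowns nu mu l (\<alpha> ^ n) (\<rho> ^ n)))"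
        unfolding J0_def initial_constraints_iff[OF real Reals_power[OF \<rho>]] Q_def complex_cnj_power ..
      moreover have upd0: "(unknowns nu mu l a z)(0 := 0) = unknowns 0 mu l a z"
          "(unknowns nu mu l a z)(1 := 0) = unknowns nu 0 l a z" for nu mu l a z
        using unknowns_upd[of nu mu l a z 0] by (simp_all only: of_real_0)
      moreover have "(\<exists>nu. \<forall>c\<in>J0. 0 \<le> pairing c (unknowns nu mu l a z)) \<longleftrightarrow>
          (\<forall>c\<in>J1. 0 \<le> pairing c (unknowns 0 mu l a z))" for mu l a z
        using eliminate_iff[OF fin(1), of 0 "unknowns 0 mu l a z"] wf0
        unfolding J1_def unknowns_upd upd0 by (simp add: well_formed_def)
      moreover have "(\<exists>mu. \<forall>c\<in>J1. 0 \<le> pairing c (unknowns 0 mu l a z)) \<longleftrightarrow>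
          (\<forall>c\<in>J2. 0 \<le> pairing c (unknowns 0 0 l a z))" for l a z
        using eliminate_iff[OF fin(2), of 1 "unknowns 0 0 l a z"] wf1
        unfolding J2_def unknowns_upd upd0 by (simp add: well_formed_def)
      ultimately show ?thesis by simp
    qed
    have Q_cong: "Q n \<longleftrightarrow> Q n'" if "\<And>\<phi>. \<phi> \<in> T \<Longrightarrow>
        sgn (Re (atom_value \<alpha> \<rho> n \<phi>)) = sgn (Re (atom_value \<alpha> \<rho> n' \<phi>))" for n n'
      unfolding Q_iff using fin(3) wf2 \<rho> zero2 that unfolding T_def by (rule ex_parameter_cong)
    obtain Sys :: "nat \<Rightarrow> complex atom list" where len: "\<And>i. length (Sys i) \<le> N + 1"
      and Sys: "\<And>i \<phi>. \<phi> \<in> set (Sys i) \<Longrightarrow> \<phi> = false_atom \<or> (\<exists>\<sigma>. \<exists>\<psi>\<in>T. \<phi> = with_sign \<sigma> \<psi>)"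
      and Q: "\<And>n. Q n \<longleftrightarrow> (\<exists>i\<in>{1..3 ^ N}. \<forall>\<phi>\<in>set (Sys i). atom_holds \<alpha> \<rho> n \<phi>)"
    proof (rule ex_sign_systems[where \<alpha> = \<alpha> and Q = Q, OF fin(4) cardT _ \<rho>])
      show "admissible \<phi>" if "\<phi> \<in> T" for \<phi> using that by (rule adm)
      show "Q n \<longleftrightarrow> Q n'" if "\<And>\<phi>. \<phi> \<in> T \<Longrightarrow>
          sgn (Re (atom_value \<alpha> \<rho> n \<phi>)) = sgn (Re (atom_value \<alpha> \<rho> n' \<phi>))" for n n'
        using that by (rule Q_cong)
    qed (rule that)
    have lev_Sys: "level 9 S x" if "1 \<le> S"
        "\<forall>i\<in>{1..3}. level 0 S (f i) \<and> level 0 S (g i) \<and> level 0 S (h i) \<and> level 0 S (k i) \<and>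
          level 0 S (s i) \<and> level 0 S (t i) \<and> level 0 S (r i)"
        "\<phi> \<in> set (Sys i)" "x \<in> set_atom \<phi>" for S i \<phi> x
      using Sys[OF that(3)]
    proof
      assume "\<phi> = false_atom"
      then show ?thesis using that(4) level_0_1[OF that(1)] by (auto simp: false_atom_def)
    next
      assume "\<exists>\<sigma>. \<exists>\<psi>\<in>T. \<phi> = with_sign \<sigma> \<psi>"
      then obtain \<sigma> \<psi> where \<psi>: "\<psi> \<in> T" "\<phi> = with_sign \<sigma> \<psi>" by blast
      have "level (Suc 8) S x"
        using level_with_sign[OF lev[OF that(1,2) \<psi>(1)] that(1)] that(4) \<psi>(2) by blast
      then show ?thesis by simp
    qed
    have adm_Sys: "admissible \<phi>" if "\<phi> \<in> set (Sys i)" for i \<phi>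
    proof (rule admissibleI)
      show "real_coeffs \<phi>"
        using Sys[OF that] realT real_coeffs_with_sign by (auto simp: false_atom_def real_coeffs_def)
      show "level 9 S0 x" if "x \<in> set_atom \<phi>" for x using lev_Sys S0 \<open>\<phi> \<in> set (Sys i)\<close> that by blast
    qed

    show ?case
    proof (intro exI[of _ Sys] conjI ballI allI impI, goal_cases)
      case (1 i)
      show ?case by (rule len)
    next
      case (2 i \<phi>)
      then show ?case by (intro adm_Sys)
    next
      case (3 n)
      show ?case using Q unfolding Q_def .
    next
      case (4 R\<alpha> R\<rho> Rf Rg Rh Rk Rs Rt Rr i)
      define S where "S = rep_size R\<alpha> + rep_size R\<rho> + (\<Sum>j=1..3. rep_size (Rf j) + rep_size (Rg j)
          + rep_size (Rh j) + rep_size (Rk j) + rep_size (Rs j) + rep_size (Rt j) + rep_size (Rr j))"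
      from input[OF S_def] 4 have "1 \<le> S \<and> (\<forall>i\<in>{1..3}. level 0 S (f i) \<and> level 0 S (g i) \<and>
          level 0 S (h i) \<and> level 0 S (k i) \<and> level 0 S (s i) \<and> level 0 S (t i) \<and> level 0 S (r i))"
        by blast
      then have "level 9 S x" if "\<phi> \<in> set (Sys i)" "x \<in> set_atom \<phi>" for \<phi> x
        using lev_Sys that by blast
      then obtain \<Delta> where \<Delta>: "describes \<Delta> (Sys i)"
        "description_size \<Delta> \<le> length (Sys i) * (7 * rep_bound ((op_bound ^^ 9) S) + 1)"
        using ex_small_description by blast
      note \<Delta>(2)
      also have "length (Sys i) * (7 * rep_bound ((op_bound ^^ 9) S) + 1) \<le> poly P S"
        unfolding P using len by (rule mult_le_mono1)
      finally show ?case using \<Delta>(1) unfolding S_def by blast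
    qed
  qed
qed

end
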